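(* Let $\psi$ be an approximating function and let $\mathcal{C}\in\mathcal{Q}$. If $$\sum_{h=1}^\infty\psi(h)\log h<\infty,$$ then $|\mathcal{C}\cap\mathcal{S}^*_2(\psi)|_{\mathcal{C}}=0$.
   Context: An approximating function is a decreasing function $\psi:\mathbb{R}^+\to\mathbb{R}^+$ (with positive real values). For $x\in\mathbb{R}$ put $\|x\|=\min\{|x-m|:m\in\mathbb{Z}\}$. For an approximating function $\psi$, $\mathcal{S}^*_2(\psi)$ is the set of $(y_1,y_2)\in\mathbb{R}^2$ for which there are infinitely many $q\in\mathbb{N}$ such that $\|qy_1\|\cdot\|qy_2\|<\psi(q)$. $\mathcal{Q}$ is the class of non-degenerate rational quadrics: a planar curve $\mathcal{C}$ is in $\mathcal{Q}$ if it is the image of one of the unit circle $\{(x_1,x_2)\in\mathbb{R}^2:x_1^2+x_2^2=1\}$, the parabola $\{(x_1,x_2)\in\mathbb{R}^2:x_2=x_1^2\}$, or the hyperbola $\{(x_1,x_2)\in\mathbb{R}^2:x_1^2-x_2^2=1\}$ under a rational affine transformation of the plane, i.e. a map $x\mapsto Ax+b$ with $A\in GL_2(\mathbb{Q})$ and $b\in\mathbb{Q}^2$. $|\cdot|_{\mathcal{C}}$ denotes the induced one-dimensional Lebesgue measure on $\mathcal{C}$. *)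

theory Defs
  imports "HOL-Analysis.Analysis"
begin

text \<open>Values of \<^term>\<open>\<psi>\<close> outside the positive reals are irrelevant.
  ``Decreasing'' is read in the weak sense (non-increasing).\<close>

definition approximating_function :: "(real \<Rightarrow> real) \<Rightarrow> bool" where
  "approximating_function \<psi> \<longleftrightarrow> antimono_on {0<..} \<psi> \<and> (\<forall>x>0. \<psi> x > 0)"

definition dist_int :: "real \<Rightarrow> real" where
  "dist_int x = (INF m::int. \<bar>x - of_int m\<bar>)"

text \<open>The infimum is a minimum.\<close>

lemma dist_int_le: "dist_int x \<le> \<bar>x - of_int m\<bar>"
  unfolding dist_int_def by (rule cINF_lower) (auto intro: bdd_belowI[of _ 0])

lemma dist_int_attained: "\<exists>m::int. dist_int x = \<bar>x - of_int m\<bar>"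
proof -
  have "\<bar>x - of_int (round x)\<bar> \<le> dist_int x"
    unfolding dist_int_def
  proof (rule cINF_greatest)
    show "\<bar>x - of_int (round x)\<bar> \<le> \<bar>x - of_int m\<bar>" for m
      using round_diff_minimal[of x m] by simp
  qed simp
  then show ?thesis
    using dist_int_le[of x "round x"] by (intro exI[of _ "round x"]) linarith
qed

definition S2_star :: "(real \<Rightarrow> real) \<Rightarrow> (real ^ 2) set" where
  "S2_star \<psi> = {y. infinite {q::nat. q > 0 \<and>
      dist_int (real q * y $ 1) * dist_int (real q * y $ 2) < \<psi> (real q)}}"

definition unit_circle :: "(real ^ 2) set" where
  "unit_circle = {x. (x $ 1)\<^sup>2 + (x $ 2)\<^sup>2 = 1}"

definition std_parabola :: "(real ^ 2) set" where
  "std_parabola = {x. x $ 2 = (x $ 1)\<^sup>2}"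

definition std_hyperbola :: "(real ^ 2) set" where
  "std_hyperbola = {x. (x $ 1)\<^sup>2 - (x $ 2)\<^sup>2 = 1}"

definition rational_affine :: "rat ^ 2 ^ 2 \<Rightarrow> rat ^ 2 \<Rightarrow> real ^ 2 \<Rightarrow> real ^ 2" where
  "rational_affine A b x = map_matrix of_rat A *v x + (\<chi> i. of_rat (b $ i))"

definition rational_quadrics :: "(real ^ 2) set set" where
  "rational_quadrics = {rational_affine A b ` K |A b K.
      invertible A \<and> K \<in> {unit_circle, std_parabola, std_hyperbola}}"

definition path_length :: "(real \<Rightarrow> real ^ 2) \<Rightarrow> real" where
  "path_length g = integral {0..1} (\<lambda>t. norm (vector_derivative g (at t)))"

text \<open>The one-dimensional Lebesgue measure induced on a curve \<^term>\<open>C\<close>, given by Lebesgue's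
  construction with arcs of \<^term>\<open>C\<close> and their arc length in place of intervals and their length.
  This is an outer measure, defined for every subset \<^term>\<open>E\<close> of \<^term>\<open>C\<close>; on a smooth
  embedded curve it agrees on Borel sets with the integral of the arc-length element.
  Since it is not a measure in the sense of \<^typ>\<open>'a measure\<close>, measure zero cannot hold
  merely for lack of measurability.\<close>

definition curve_measure :: "(real ^ 2) set \<Rightarrow> (real ^ 2) set \<Rightarrow> ennreal" where
  "curve_measure C E =
     (INF g \<in> {g :: nat \<Rightarrow> real \<Rightarrow> real ^ 2.
                 (\<forall>i. g i C1_differentiable_on {0..1} \<and> path_image (g i) \<subseteq> C) \<and>
                 E \<subseteq> (\<Union>i. path_image (g i))}.
        \<Sum>i. ennreal (path_length (g i)))"

end

theory Submission
  imports Defs "HOL-Real_Asymp.Real_Asymp"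
begin

text \<open>
  A rational quadric is a conic \<open>{y. x\<^sup>2 = a b}\<close>, where \<open>(a, x, b) = H (y\<^sub>1, y\<^sub>2, 1)\<close> for an
  invertible integer matrix \<open>H\<close>, and it is parametrised rationally by \<open>t = x / a\<close>. An approximation
  \<open>(p\<^sub>1 / q, p\<^sub>2 / q)\<close> of a point of the conic is mapped by \<open>H\<close> to an integer triple with
  \<open>\<bar>x\<^sup>2 - a b\<bar> \<le> \<delta> a\<close>, where \<open>\<delta>\<close> is of the order of \<open>max \<parallel>q y\<^sub>1\<parallel> \<parallel>q y\<^sub>2\<parallel>\<close>. For \<open>q\<close> of size \<open>Q\<close> there are
  \<open>O(\<delta> Q\<^sup>2 + Q log\<^sup>2 Q)\<close> such triples, and each of them accounts for an arc of length
  \<open>O(min \<parallel>q y\<^sub>1\<parallel> \<parallel>q y\<^sub>2\<parallel> / Q)\<close>. Splitting \<open>\<parallel>q y\<^sub>1\<parallel> \<parallel>q y\<^sub>2\<parallel> < \<psi>(q)\<close> dyadically into \<open>O(log Q)\<close> boxes therefore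
  bounds the contribution of the block \<open>Q \<le> q < 2 Q\<close> by \<open>O(log Q (Q \<psi>(Q) + log\<^sup>4 Q / Q))\<close>, which is
  summable over dyadic \<open>Q\<close>, and the convergence part of the Borel--Cantelli argument applies.

  The counting bound is elementary. Dirichlet's theorem gives \<open>x / a\<close> close to \<open>r / s\<close> with
  \<open>s \<le> S\<close>, \<open>S\<^sup>2\<close> of the order of \<open>Q\<close>. With \<open>k = s x - r a\<close> and \<open>m = r\<^sup>2 a + 2 r k - s\<^sup>2 b\<close> one has
  \<open>s\<^sup>2 (x\<^sup>2 - a b) = a m + k\<^sup>2\<close> and \<open>k\<^sup>2 \<le> a / 2\<close>, so \<open>m\<close> is small; \<open>r\<close> and \<open>m\<close> determine \<open>k\<close>
  modulo \<open>s\<close>, and \<open>r\<close>, \<open>k\<close>, \<open>m\<close> determine \<open>a\<close> modulo \<open>s\<^sup>2\<close>.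
\<close>

section \<open>Integer triples near the cone \<open>x\<^sup>2 = a b\<close>\<close>

text \<open>Subtracting the least element and dividing by \<open>n\<close> injects \<open>X\<close>
  into the integers between 0 and \<open>(v - u) / n\<close>.\<close>

lemma card_congruent_le:
  fixes X :: "int set" and u v :: real and n :: int
  assumes n: "n > 0" and uv: "u \<le> v"
    and X: "\<And>x. x \<in> X \<Longrightarrow> u \<le> x \<and> x \<le> v"
    and dvd: "\<And>x y. x \<in> X \<Longrightarrow> y \<in> X \<Longrightarrow> n dvd x - y"
  shows "finite X \<and> real (card X) \<le> (v - u) / n + 1"
proof -
  have sub: "X \<subseteq> {\<lceil>u\<rceil>..\<lfloor>v\<rfloor>}"
    using X by (auto simp: ceiling_le_iff le_floor_iff)
  then have fin: "finite X" by (rule finite_subset) simp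
  have "real (card X) \<le> (v - u) / n + 1"
  proof (cases "X = {}")
    case True
    then show ?thesis using n uv by simp
  next
    case False
    define x0 where "x0 = Min X"
    have x0: "x0 \<in> X" "\<And>x. x \<in> X \<Longrightarrow> x0 \<le> x"
      using False fin by (auto simp: x0_def)
    let ?f = "\<lambda>x. (x - x0) div n"
    have eq: "n * ?f x = x - x0" if "x \<in> X" for x
      using dvd[OF that x0(1)] by simp
    have inj: "inj_on ?f X"
      by (rule inj_onI) (metis eq diff_eq_diff_eq diff_add_cancel)
    have img: "?f ` X \<subseteq> {0..\<lfloor>(v - u) / n\<rfloor>}"
    proof
      fix z assume "z \<in> ?f ` X"
      then obtain x where x: "x \<in> X" "z = ?f x" by blast
      have "z \<ge> 0" using x x0(2)[OF x(1)] n by (simp add: pos_imp_zdiv_nonneg_iff)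
      moreover have "real_of_int n * real_of_int z = x - x0"
        using eq[OF x(1)] x(2) by (metis of_int_diff of_int_mult)
      then have "real_of_int z \<le> (v - u) / n"
        using X[OF x(1)] X[OF x0(1)] n by (simp add: pos_le_divide_eq mult.commute)
      ultimately show "z \<in> {0..\<lfloor>(v - u) / n\<rfloor>}" by (simp add: le_floor_iff)
    qed
    have "card X \<le> card {0..\<lfloor>(v - u) / n\<rfloor>}"
      by (metis card_image card_mono finite_atLeastAtMost_int img inj)
    also have "\<dots> = nat (\<lfloor>(v - u) / n\<rfloor> + 1)" by simp
    finally have "real (card X) \<le> real_of_int (\<lfloor>(v - u) / n\<rfloor> + 1)"
      using n uv by (simp add: le_nat_iff)
    then show ?thesis by linarith
  qed
  with fin show ?thesis by blast
qed

lemma card_Sigma_le: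
  fixes c d :: real
  assumes "finite P" "real (card P) \<le> d" "c \<ge> 0"
    and "\<And>p. p \<in> P \<Longrightarrow> finite (F p) \<and> real (card (F p)) \<le> c"
  shows "finite (Sigma P F) \<and> real (card (Sigma P F)) \<le> d * c"
proof -
  have "real (card (Sigma P F)) = (\<Sum>p\<in>P. real (card (F p)))"
    using assms by (simp add: card_SigmaI)
  also have "\<dots> \<le> real (card P) * c"
    using assms(4) by (intro sum_bounded_above) auto
  also have "\<dots> \<le> d * c"
    using assms by (intro mult_right_mono) auto
  finally show ?thesis using assms by (auto intro: finite_SigmaI)
qed

text \<open>The codes \<open>(((r, m), k), a)\<close> of the counting argument, for a fixed denominator \<open>s\<close>.\<close>

definition near_square_codes ::
  "real \<Rightarrow> real \<Rightarrow> real \<Rightarrow> real \<Rightarrow> int \<Rightarrow> (((int \<times> int) \<times> int) \<times> int) set" where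
  "near_square_codes R M K A s =
    (SIGMA p : (SIGMA p : {r. \<bar>real_of_int r\<bar> \<le> R \<and> coprime r s} \<times> {m. \<bar>real_of_int m\<bar> \<le> M}.
        {k. \<bar>real_of_int k\<bar> \<le> K \<and> s dvd snd p - fst p * k}).
      {a. 0 \<le> a \<and> real_of_int a \<le> A \<and>
          s\<^sup>2 dvd (fst (fst p))\<^sup>2 * a + 2 * fst (fst p) * snd p - snd (fst p)})"

text \<open>\<open>r\<close> and \<open>m\<close> are counted by size alone. Since \<open>r\<close>
  is invertible modulo \<open>s\<close>, they confine \<open>k\<close> to one class modulo
  \<open>s\<close>, and then \<open>a\<close> to one class modulo \<open>s\<^sup>2\<close>. The four
  factors count the choices in this order.\<close>

lemma card_near_square_codes:
  fixes s :: int
  assumes "s > 0" "R \<ge> 0" "M \<ge> 0" "K \<ge> 0" "A \<ge> 0"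
  shows "finite (near_square_codes R M K A s) \<and>
    real (card (near_square_codes R M K A s)) \<le>
      (2 * R + 1) * (2 * M + 1) * (2 * K / s + 1) * (A / s\<^sup>2 + 1)"
proof -
  have 0: "finite {r. \<bar>real_of_int r\<bar> \<le> R \<and> coprime r s} \<and>
      real (card {r. \<bar>real_of_int r\<bar> \<le> R \<and> coprime r s}) \<le> 2 * R + 1"
    using card_congruent_le[of 1 "-R" R "{r. \<bar>real_of_int r\<bar> \<le> R \<and> coprime r s}"] assms
    by (simp add: abs_le_iff)
  have 1: "finite {m. \<bar>real_of_int m\<bar> \<le> M} \<and> real (card {m. \<bar>real_of_int m\<bar> \<le> M}) \<le> 2 * M + 1"
    using card_congruent_le[of 1 "-M" M "{r. \<bar>real_of_int r\<bar> \<le> M}"] assms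
    by (simp add: abs_le_iff)
  have 2: "finite ({r. \<bar>real_of_int r\<bar> \<le> R \<and> coprime r s} \<times> {m. \<bar>real_of_int m\<bar> \<le> M}) \<and>
      real (card ({r. \<bar>real_of_int r\<bar> \<le> R \<and> coprime r s} \<times> {m. \<bar>real_of_int m\<bar> \<le> M}))
        \<le> (2 * R + 1) * (2 * M + 1)"
    using 0 1 assms by (intro card_Sigma_le) auto
  have k: "finite {k. \<bar>real_of_int k\<bar> \<le> K \<and> s dvd m - r * k} \<and>
      real (card {k. \<bar>real_of_int k\<bar> \<le> K \<and> s dvd m - r * k}) \<le> (K - (-K)) / s + 1"
    if "coprime r s" for r m
  proof (rule card_congruent_le)
    fix x y assume "x \<in> {k. \<bar>real_of_int k\<bar> \<le> K \<and> s dvd m - r * k}"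
      "y \<in> {k. \<bar>real_of_int k\<bar> \<le> K \<and> s dvd m - r * k}"
    then have "s dvd m - r * x" "s dvd m - r * y" by auto
    from dvd_diff[OF this(2,1)] have "s dvd r * (x - y)" by (simp add: algebra_simps)
    then show "s dvd x - y"
      using that by (simp add: coprime_commute coprime_dvd_mult_right_iff)
  qed (use assms in auto)
  have a: "finite {a. 0 \<le> a \<and> real_of_int a \<le> A \<and> s\<^sup>2 dvd r\<^sup>2 * a + 2 * r * k - m} \<and>
      real (card {a. 0 \<le> a \<and> real_of_int a \<le> A \<and> s\<^sup>2 dvd r\<^sup>2 * a + 2 * r * k - m})
        \<le> (A - 0) / real_of_int (s\<^sup>2) + 1"
    if "coprime r s" for r m k
  proof (rule card_congruent_le)
    fix x y assume "x \<in> {a. 0 \<le> a \<and> real_of_int a \<le> A \<and> s\<^sup>2 dvd r\<^sup>2 * a + 2 * r * k - m}"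
      "y \<in> {a. 0 \<le> a \<and> real_of_int a \<le> A \<and> s\<^sup>2 dvd r\<^sup>2 * a + 2 * r * k - m}"
    then have "s\<^sup>2 dvd r\<^sup>2 * x + 2 * r * k - m" "s\<^sup>2 dvd r\<^sup>2 * y + 2 * r * k - m" by auto
    from dvd_diff[OF this] have "s\<^sup>2 dvd r\<^sup>2 * (x - y)" by (simp add: algebra_simps)
    moreover have "coprime (s\<^sup>2) (r\<^sup>2)" using that by (simp add: coprime_commute)
    ultimately show "s\<^sup>2 dvd x - y" by (simp add: coprime_dvd_mult_right_iff)
  qed (use assms in auto)
  let ?P = "SIGMA p : {r. \<bar>real_of_int r\<bar> \<le> R \<and> coprime r s} \<times> {m. \<bar>real_of_int m\<bar> \<le> M}.
        {k. \<bar>real_of_int k\<bar> \<le> K \<and> s dvd snd p - fst p * k}"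
  have 3: "finite ?P \<and> real (card ?P) \<le> (2 * R + 1) * (2 * M + 1) * (2 * K / s + 1)"
  proof (rule card_Sigma_le)
    fix p assume "p \<in> {r. \<bar>real_of_int r\<bar> \<le> R \<and> coprime r s} \<times> {m. \<bar>real_of_int m\<bar> \<le> M}"
    then show "finite {k. \<bar>real_of_int k\<bar> \<le> K \<and> s dvd snd p - fst p * k} \<and>
        real (card {k. \<bar>real_of_int k\<bar> \<le> K \<and> s dvd snd p - fst p * k}) \<le> 2 * K / s + 1"
      using k[of "fst p" "snd p"] by auto
  qed (use 2 assms in auto)
  show ?thesis
    unfolding near_square_codes_def
  proof (rule card_Sigma_le)
    fix p assume "p \<in> ?P"
    then show "finite {a. 0 \<le> a \<and> real_of_int a \<le> A \<and>
          s\<^sup>2 dvd (fst (fst p))\<^sup>2 * a + 2 * fst (fst p) * snd p - snd (fst p)} \<and>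
        real (card {a. 0 \<le> a \<and> real_of_int a \<le> A \<and>
          s\<^sup>2 dvd (fst (fst p))\<^sup>2 * a + 2 * fst (fst p) * snd p - snd (fst p)}) \<le> A / s\<^sup>2 + 1"
      using a[of "fst (fst p)" "snd p" "snd (fst p)"] by auto
  qed (use 3 assms in auto)
qed

text \<open>The tolerance is proportional to \<open>a\<close>: moving a point (a, x, b) of the cone
  by \<delta> changes x^2 - a b by the order of \<delta> a as long as x and b are of the order of
  \<open>a\<close>. The bound by \<open>B\<close> keeps the slope x / a in a compact range.\<close>

definition near_squares :: "real \<Rightarrow> real \<Rightarrow> real \<Rightarrow> (int \<times> int \<times> int) set" where
  "near_squares A B \<delta> = {(a, x, b). 0 < a \<and> real_of_int a \<le> A \<and> \<bar>real_of_int x\<bar> \<le> B * a \<and>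
     \<bar>real_of_int (x\<^sup>2 - a * b)\<bar> \<le> \<delta> * a}"

text \<open>Here \<open>r / s\<close> is a Dirichlet approximation to \<open>x / a\<close>, and
  \<open>k\<close>, \<open>m\<close> are the remainders in s x = r a + k and s^2 b = r^2 a + 2 r k -
  m. Every triple can thus be read off from a code, so the number of codes bounds the number of
  triples.\<close>

lemma near_squares_decode:
  fixes S :: nat and A B \<delta> :: real
  assumes "(a, x, b) \<in> near_squares A B \<delta>" and S: "2 * A \<le> (real S)\<^sup>2" "S > 0"
    and "A > 0" "\<delta> > 0"
  obtains s :: nat and r m k :: int where "s \<in> {1..S}"
    "(((r, m), k), a) \<in> near_square_codes (s * (B + 1))
       (if s\<^sup>2 * \<delta> < 1/2 then 0 else s\<^sup>2 * \<delta> + 1/2)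
       (if s\<^sup>2 * \<delta> < 1/2 then s * sqrt (\<delta> * A) else S) A (int s)"
    "x = (r * a + k) div int s" "b = (r\<^sup>2 * a + 2 * r * k - m) div (int s)\<^sup>2"
proof -
  have a: "0 < a" "real_of_int a \<le> A" and xB: "\<bar>real_of_int x\<bar> \<le> B * a"
    and xd: "\<bar>real_of_int (x\<^sup>2 - a * b)\<bar> \<le> \<delta> * a"
    using assms(1) by (auto simp: near_squares_def)
  obtain r t where rt: "coprime r t" "0 < t" "t \<le> int S"
      "\<bar>of_int t * (real_of_int x / real_of_int a) - of_int r\<bar> < 1 / S"
    using Dirichlet_approx_coprime[OF S(2)] by metis
  define s where "s = nat t"
  have s: "int s = t" "s \<in> {1..S}" using rt by (auto simp: s_def)
  have s1: "real s \<ge> 1" and sS: "real s \<le> S" and ts: "real_of_int t = real s"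
    using s by auto
  define k where "k = t * x - r * a"
  define m where "m = r\<^sup>2 * a + 2 * r * k - t\<^sup>2 * b"
  have key: "t\<^sup>2 * (x\<^sup>2 - a * b) = a * m + k\<^sup>2"
    unfolding m_def k_def by (simp add: algebra_simps power2_eq_square)
  have "real_of_int k = (of_int t * (real_of_int x / real_of_int a) - of_int r) * a"
    using a by (simp add: k_def field_simps)
  then have kS: "\<bar>real_of_int k\<bar> < a / S"
    using mult_strict_right_mono[OF rt(4), of "real_of_int a"] a by (simp add: abs_mult)
  have "real_of_int a * 2 \<le> (real S)\<^sup>2" using a S by linarith
  then have "real_of_int a / S \<le> S / 2"
    using S(2) by (simp add: field_simps power2_eq_square)
  then have kS2: "\<bar>real_of_int k\<bar> \<le> S / 2" using kS by linarith
  \<comment> \<open>Two bounds for \<open>\<bar>k\<bar>\<close> are multiplied: \<open>a / S\<close>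
    from Dirichlet's theorem and \<open>S / 2\<close> from \<open>2 * A \<le> S\<^sup>2\<close>. The
    resulting 1/2 is what forces the integer \<open>m\<close> to vanish when
    \<open>s\<^sup>2 * \<delta> < 1/2\<close>.\<close>
  have k2: "(real_of_int k)\<^sup>2 \<le> a / 2"
  proof -
    have "(real_of_int k)\<^sup>2 = \<bar>real_of_int k\<bar> * \<bar>real_of_int k\<bar>" by (simp add: power2_eq_square)
    also have "\<dots> \<le> (a / S) * (S / 2)"
      using kS kS2 S(2) a by (intro mult_mono) auto
    finally show ?thesis using S(2) by simp
  qed
  have "\<bar>real_of_int (a * m + k\<^sup>2)\<bar> = (real s)\<^sup>2 * \<bar>real_of_int (x\<^sup>2 - a * b)\<bar>"
    unfolding key[symmetric] using ts by (simp add: abs_mult)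
  also have "\<dots> \<le> (real s)\<^sup>2 * (\<delta> * a)" using xd by (intro mult_left_mono) auto
  finally have am: "\<bar>real_of_int a * real_of_int m + (real_of_int k)\<^sup>2\<bar> \<le> a * ((real s)\<^sup>2 * \<delta>)"
    by (simp add: mult_ac)
  have "real_of_int a * \<bar>real_of_int m\<bar> = \<bar>real_of_int a * real_of_int m\<bar>" using a by (simp add: abs_mult)
  also have "\<dots> \<le> real_of_int a * ((real s)\<^sup>2 * \<delta>) + a / 2"
    using am k2 zero_le_power2[of "real_of_int k"] by linarith
  also have "\<dots> = a * ((real s)\<^sup>2 * \<delta> + 1/2)" by (simp add: algebra_simps)
  finally have m_le: "\<bar>real_of_int m\<bar> \<le> (real s)\<^sup>2 * \<delta> + 1/2"
    using a by simp
  \<comment> \<open>For small \<open>s\<close> the integer \<open>m\<close> vanishes, so \<open>s\<close> divides \<open>k\<close>, and \<open>k\<close> obeys a sharper bound.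
    Without this case the count would acquire a term of order \<open>Q\<^sup>3\<^sup>/\<^sup>2\<close>, which is just too large.\<close>
  have m0: "m = 0" if "(real s)\<^sup>2 * \<delta> < 1/2"
    using m_le that by linarith
  have "(real_of_int k)\<^sup>2 \<le> (s * sqrt (\<delta> * A))\<^sup>2" if "(real s)\<^sup>2 * \<delta> < 1/2"
  proof -
    have "(real_of_int k)\<^sup>2 \<le> a * ((real s)\<^sup>2 * \<delta>)"
      using am m0[OF that] by simp
    also have "\<dots> \<le> A * ((real s)\<^sup>2 * \<delta>)"
      using a assms by (intro mult_right_mono) auto
    also have "\<dots> = (s * sqrt (\<delta> * A))\<^sup>2"
      using assms by (simp add: power_mult_distrib)
    finally show ?thesis .
  qed
  then have k0: "\<bar>real_of_int k\<bar> \<le> s * sqrt (\<delta> * A)" if "(real s)\<^sup>2 * \<delta> < 1/2"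
    using that assms by (intro power2_le_imp_le[of "\<bar>real_of_int k\<bar>"]) auto
  have r_le: "\<bar>real_of_int r\<bar> \<le> s * (B + 1)"
  proof -
    have "\<bar>real_of_int x / real_of_int a\<bar> \<le> B"
      using xB a by (simp add: field_simps)
    then have "\<bar>of_int t * (real_of_int x / real_of_int a)\<bar> \<le> s * B"
      unfolding abs_mult using ts by (intro mult_mono) auto
    moreover have "1 / real S \<le> 1" using S by simp
    ultimately have "\<bar>real_of_int r\<bar> \<le> s * B + s" using rt(4) s1 by linarith
    then show ?thesis by (simp add: algebra_simps)
  qed
  have "m - r * k = t * (r * x - t * b)"
    by (simp add: m_def k_def algebra_simps power2_eq_square)
  then have d1: "t dvd m - r * k" by simp
  have e2: "r\<^sup>2 * a + 2 * r * k - m = t\<^sup>2 * b" by (simp add: m_def)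
  show thesis
  proof (rule that[of s r m k])
    show "s \<in> {1..S}" by (fact s(2))
    show "x = (r * a + k) div int s" using rt(2) by (simp add: s k_def)
    show "b = (r\<^sup>2 * a + 2 * r * k - m) div (int s)\<^sup>2" using rt(2) by (simp add: s e2)
    show "(((r, m), k), a) \<in> near_square_codes (s * (B + 1))
       (if s\<^sup>2 * \<delta> < 1/2 then 0 else s\<^sup>2 * \<delta> + 1/2)
       (if s\<^sup>2 * \<delta> < 1/2 then s * sqrt (\<delta> * A) else S) A (int s)"
      unfolding near_square_codes_def
      using r_le m_le m0 k0 kS2 d1 e2 rt(1) a by (auto simp: s)
  qed
qed

lemma harm_le_ln: "n > 0 \<Longrightarrow> harm n \<le> 1 + ln (real n)"
  using decseq_harm_diff_ln[THEN decseqD, of 0 "n - 1"] by (simp add: harm_expand)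

text \<open>For \<open>s\<^sup>2 * \<delta> < 1/2\<close> only \<open>m = 0\<close> occurs and the
  bound decays like \<open>1 / s\<close>, which sums to a logarithm. For larger \<open>s\<close> the
  bound is independent of \<open>s\<close>, and summing it over \<open>s \<le> S\<close> gives the
  main term of order \<open>\<delta> * A\<^sup>2\<close>.\<close>

lemma card_near_square_codes_le:
  fixes s S :: nat and A B \<delta> :: real
  assumes "s \<in> {1..S}" "A \<le> (real S)\<^sup>2" "A > 0" "\<delta> > 0" "B \<ge> 0"
  defines "P \<equiv> near_square_codes (s * (B + 1))
       (if s\<^sup>2 * \<delta> < 1/2 then 0 else s\<^sup>2 * \<delta> + 1/2)
       (if s\<^sup>2 * \<delta> < 1/2 then s * sqrt (\<delta> * A) else S) A (int s)"
  shows "finite P \<and> real (card P) \<le>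
    (2 * B + 3) * (2 * (real S)\<^sup>2 * (2 * sqrt (\<delta> * A) + 1) * inverse (real s) + 36 * (real S)^3 * \<delta>)"
proof -
  have s: "real s > 0" "real s \<ge> 1" "real s \<le> S" using assms(1) by auto
  define M where "M = (if s\<^sup>2 * \<delta> < 1/2 then 0 else s\<^sup>2 * \<delta> + 1/2)"
  define K where "K = (if s\<^sup>2 * \<delta> < 1/2 then s * sqrt (\<delta> * A) else S)"
  have nonneg: "M \<ge> 0" "K \<ge> 0" using assms by (auto simp: M_def K_def)
  have fin: "finite P" and card: "real (card P) \<le>
      (2 * (s * (B + 1)) + 1) * (2 * M + 1) * (2 * K / s + 1) * (A / s\<^sup>2 + 1)"
    using card_near_square_codes[of "int s" "s * (B + 1)" M K A] nonneg s assms
    unfolding P_def M_def[symmetric] K_def[symmetric] by auto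
  have e1: "2 * (s * (B + 1)) + 1 \<le> s * (2 * B + 3)"
    using s by (simp add: algebra_simps)
  have "(real s)\<^sup>2 \<le> (real S)\<^sup>2" using s by (intro power_mono) auto
  then have "A + (real s)\<^sup>2 \<le> 2 * (real S)\<^sup>2" using assms(2) by linarith
  then have "(A + (real s)\<^sup>2) / (real s)\<^sup>2 \<le> 2 * (real S)\<^sup>2 / (real s)\<^sup>2"
    by (intro divide_right_mono) auto
  then have e2: "A / s\<^sup>2 + 1 \<le> 2 * (real S)\<^sup>2 / s\<^sup>2"
    using s by (simp add: add_divide_distrib)
  have c2: "real (card P) \<le> s * (2 * B + 3) * ((2 * M + 1) * (2 * K / s + 1)) * (2 * (real S)\<^sup>2 / s\<^sup>2)"
    (is "_ \<le> ?X")
  proof (rule order_trans[OF card], goal_cases)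
    case 1
    have "(2 * (s * (B + 1)) + 1) * ((2 * M + 1) * (2 * K / s + 1)) * (A / s\<^sup>2 + 1) \<le> ?X"
      using e1 e2 nonneg assms by (intro mult_mono) auto
    then show ?case by (simp only: mult.assoc)
  qed
  have "?X \<le> (2 * B + 3) * (2 * (real S)\<^sup>2 * (2 * sqrt (\<delta> * A) + 1) * inverse (real s) + 36 * (real S)^3 * \<delta>)"
  proof (cases "s\<^sup>2 * \<delta> < 1/2")
    case True
    then have "?X = (2 * B + 3) * (2 * (real S)\<^sup>2 * (2 * sqrt (\<delta> * A) + 1) * inverse (real s))"
      using s by (simp add: M_def K_def field_simps power2_eq_square)
    also have "\<dots> \<le> (2 * B + 3) * (2 * (real S)\<^sup>2 * (2 * sqrt (\<delta> * A) + 1) * inverse (real s) + 36 * (real S)^3 * \<delta>)"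
      using assms by (intro mult_left_mono) auto
    finally show ?thesis .
  next
    case False
    \<comment> \<open>As 1/2 \<le> \<open>s\<^sup>2 * \<delta>\<close>, the additive 2 in
      \<open>2 * M + 1\<close> is at most \<open>4 * s\<^sup>2 * \<delta>\<close>; in the next
      factor 1 \<le> \<open>S / s\<close> plays the same part.\<close>
    have "2 * M + 1 \<le> 6 * (s\<^sup>2 * \<delta>)" using False by (simp add: M_def mult.commute)
    moreover have "2 * K / s + 1 \<le> 3 * S / s" using False s by (simp add: K_def field_simps)
    ultimately have "(2 * M + 1) * (2 * K / s + 1) \<le> (6 * (s\<^sup>2 * \<delta>)) * (3 * S / s)"
      using nonneg assms by (intro mult_mono) auto
    then have "?X \<le> s * (2 * B + 3) * ((6 * (s\<^sup>2 * \<delta>)) * (3 * S / s)) * (2 * (real S)\<^sup>2 / s\<^sup>2)"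
      using assms by (intro mult_right_mono mult_left_mono) auto
    also have "\<dots> = (2 * B + 3) * (36 * (real S)^3 * \<delta>)"
      using s by (simp add: field_simps power2_eq_square power3_eq_cube)
    also have "\<dots> \<le> (2 * B + 3) * (2 * (real S)\<^sup>2 * (2 * sqrt (\<delta> * A) + 1) * inverse (real s) + 36 * (real S)^3 * \<delta>)"
      using assms by (intro mult_left_mono) auto
    finally show ?thesis .
  qed
  with c2 fin show ?thesis by linarith
qed

lemma card_near_squares_aux:
  assumes "A \<ge> 1" "\<delta> > 0" "B \<ge> 0"
  shows "finite (near_squares A B \<delta>) \<and> real (card (near_squares A B \<delta>)) \<le>
    (2 * B + 3) * (18 * A * (2 * sqrt (\<delta> * A) + 1) * (3 * (1 + ln A)) + 2916 * A\<^sup>2 * \<delta>)"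
proof -
  \<comment> \<open>The least integer with \<open>2 * A \<le> S\<^sup>2\<close>. It is at most
    \<open>3 * sqrt A\<close>, so \<open>S\<^sup>2 \<le> 9 * A\<close>; this is the origin of 18 = 2
    * 9 and 2916 = 36 * 81.\<close>
  define S where "S = nat \<lceil>sqrt (2 * A)\<rceil>"
  have sq: "sqrt (2 * A) \<ge> 1" using assms by simp
  have S_ge: "real S \<ge> sqrt (2 * A)" unfolding S_def by (rule real_nat_ceiling_ge)
  have "real S \<ge> 1" using S_ge sq by linarith
  then have Spos: "S > 0" by simp
  have "(sqrt (2 * A))\<^sup>2 \<le> (real S)\<^sup>2" using S_ge sq by (intro power_mono) auto
  then have S2: "2 * A \<le> (real S)\<^sup>2" using assms by simp
  have "real S \<le> sqrt (2 * A) + 1" unfolding S_def using sq by linarith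
  also have "\<dots> \<le> 3 * sqrt A"
  proof -
    have "sqrt 2 \<le> 2" by (rule real_le_lsqrt) auto
    then have "sqrt 2 * sqrt A \<le> 2 * sqrt A" using assms by (intro mult_right_mono) auto
    moreover have "sqrt A \<ge> 1" using assms by simp
    ultimately show ?thesis unfolding real_sqrt_mult by linarith
  qed
  finally have S3: "real S \<le> 3 * sqrt A" .
  have "(real S)\<^sup>2 \<le> (3 * sqrt A)\<^sup>2" using S3 by (intro power_mono) auto
  then have S9: "(real S)\<^sup>2 \<le> 9 * A" using assms by (simp add: power_mult_distrib)
  define P where "P s = near_square_codes (real s * (B + 1))
       (if real (s\<^sup>2) * \<delta> < 1/2 then 0 else real (s\<^sup>2) * \<delta> + 1/2)
       (if real (s\<^sup>2) * \<delta> < 1/2 then real s * sqrt (\<delta> * A) else real S) A (int s)" for s :: nat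
  define f where "f = (\<lambda>(s :: nat, ((r, m), k), a). (a, (r * a + k) div int s,
        (r\<^sup>2 * a + 2 * r * k - m) div (int s)\<^sup>2))"
  have sub: "near_squares A B \<delta> \<subseteq> f ` (SIGMA s : {1..S}. P s)"
  proof
    fix z assume z: "z \<in> near_squares A B \<delta>"
    obtain a x b where [simp]: "z = (a, x, b)" by (cases z) auto
    have Apos: "A > 0" using assms by simp
    obtain s r m k where *: "s \<in> {1..S}" "(((r, m), k), a) \<in> P s"
      "x = (r * a + k) div int s" "b = (r\<^sup>2 * a + 2 * r * k - m) div (int s)\<^sup>2"
      using near_squares_decode[OF z[simplified] S2 Spos Apos assms(2)] unfolding P_def by metis
    then have "(s, ((r, m), k), a) \<in> (SIGMA s : {1..S}. P s)" by simp
    moreover have "z = f (s, ((r, m), k), a)" using * by (simp add: f_def)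
    ultimately show "z \<in> f ` (SIGMA s : {1..S}. P s)" by blast
  qed
  define g where "g s = (2 * B + 3) * (2 * (real S)\<^sup>2 * (2 * sqrt (\<delta> * A) + 1) * inverse (real s)
      + 36 * (real S)^3 * \<delta>)" for s :: nat
  have P: "finite (P s) \<and> real (card (P s)) \<le> g s" if "s \<in> {1..S}" for s
    unfolding P_def g_def using that assms S2 by (intro card_near_square_codes_le) auto
  have fin: "finite (SIGMA s : {1..S}. P s)" using P by auto
  have hl: "harm S \<le> 3 * (1 + ln A)"
  proof -
    have "ln (real S) \<le> ln (3 * sqrt A)" using S3 Spos assms by simp
    also have "\<dots> = ln 3 + ln A / 2" using assms by (simp add: ln_mult ln_sqrt)
    also have "ln 3 \<le> (2 :: real)" using ln_le_minus_one[of "3::real"] by simp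
    finally have "ln (real S) \<le> 2 + ln A / 2" by simp
    moreover have "ln A \<ge> 0" using assms by simp
    ultimately show ?thesis using harm_le_ln[OF Spos] by (simp add: field_simps)
  qed
  have "real (card (near_squares A B \<delta>)) \<le> real (card (SIGMA s : {1..S}. P s))"
    using surj_card_le[OF fin sub] by simp
  also have "\<dots> = (\<Sum>s\<in>{1..S}. real (card (P s)))"
    using P by (simp add: card_SigmaI)
  also have "\<dots> \<le> (\<Sum>s\<in>{1..S}. g s)" using P by (intro sum_mono) auto
  also have "\<dots> = (2 * B + 3) * (2 * (real S)\<^sup>2 * (2 * sqrt (\<delta> * A) + 1) * harm S
      + real S * (36 * (real S)^3 * \<delta>))"
    by (simp add: g_def harm_def sum.distrib sum_distrib_left[symmetric])
  also have "\<dots> = (2 * B + 3) * (2 * (real S)\<^sup>2 * (2 * sqrt (\<delta> * A) + 1) * harm S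
      + 36 * ((real S)\<^sup>2)\<^sup>2 * \<delta>)"
    by (simp add: power2_eq_square power3_eq_cube mult_ac)
  also have "\<dots> \<le> (2 * B + 3) * (2 * (9 * A) * (2 * sqrt (\<delta> * A) + 1) * (3 * (1 + ln A))
      + 36 * (9 * A)\<^sup>2 * \<delta>)"
    using S9 hl assms by (intro mult_left_mono add_mono mult_mono power_mono harm_nonneg) auto
  also have "\<dots> = (2 * B + 3) * (18 * A * (2 * sqrt (\<delta> * A) + 1) * (3 * (1 + ln A)) + 2916 * A\<^sup>2 * \<delta>)"
    by (simp add: power_mult_distrib)
  finally show ?thesis using finite_surj[OF fin sub] by blast
qed

text \<open>The mixed term A sqrt(\<delta> A) (1 + log A) of \<open>card_near_squares_aux\<close> is
  absorbed by the inequality of arithmetic and geometric means.\<close>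

lemma card_near_squares:
  assumes "A \<ge> 1" "\<delta> > 0" "B \<ge> 0"
  shows "finite (near_squares A B \<delta>) \<and> real (card (near_squares A B \<delta>)) \<le>
    3000 * (2 * B + 3) * (\<delta> * A\<^sup>2 + A * (1 + ln A)\<^sup>2)"
proof -
  define h where "h = 1 + ln A"
  have h: "h \<ge> 1" using assms by (simp add: h_def)
  have "2 * (sqrt (\<delta> * A) * h) \<le> \<delta> * A + h\<^sup>2"
    using sum_squares_bound[of "sqrt (\<delta> * A)" h] assms by (simp add: mult_ac)
  moreover have "h \<le> h\<^sup>2" using h by (simp add: power2_eq_square)
  ultimately have "(2 * sqrt (\<delta> * A) + 1) * h \<le> \<delta> * A + 2 * h\<^sup>2"
    by (simp add: algebra_simps)
  then have "54 * A * ((2 * sqrt (\<delta> * A) + 1) * h) \<le> 54 * A * (\<delta> * A + 2 * h\<^sup>2)"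
    using assms by (intro mult_left_mono) auto
  then have "18 * A * (2 * sqrt (\<delta> * A) + 1) * (3 * h) + 2916 * A\<^sup>2 * \<delta>
      \<le> 2970 * (\<delta> * A\<^sup>2) + 108 * (A * h\<^sup>2)"
    by (simp add: algebra_simps power2_eq_square)
  also have "\<dots> \<le> 3000 * (\<delta> * A\<^sup>2 + A * h\<^sup>2)"
  proof -
    have "\<delta> * A\<^sup>2 \<ge> 0" "A * h\<^sup>2 \<ge> 0" using assms by auto
    then show ?thesis by (simp add: algebra_simps)
  qed
  finally have "(2 * B + 3) * (18 * A * (2 * sqrt (\<delta> * A) + 1) * (3 * h) + 2916 * A\<^sup>2 * \<delta>)
      \<le> (2 * B + 3) * (3000 * (\<delta> * A\<^sup>2 + A * h\<^sup>2))"
    using assms by (intro mult_left_mono) auto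
  also have "\<dots> = 3000 * (2 * B + 3) * (\<delta> * A\<^sup>2 + A * h\<^sup>2)" by (simp only: mult_ac)
  finally show ?thesis
    using card_near_squares_aux[OF assms] unfolding h_def by (meson order_trans)
qed

section \<open>The induced measure as an outer measure\<close>

lemma curve_measure_mono: "E \<subseteq> F \<Longrightarrow> curve_measure C E \<le> curve_measure C F"
  unfolding curve_measure_def by (rule INF_superset_mono) auto

lemma curve_measure_le:
  fixes g :: "nat \<Rightarrow> real \<Rightarrow> real ^ 2"
  assumes "\<And>i. g i C1_differentiable_on {0..1}" "\<And>i. path_image (g i) \<subseteq> C"
    and "E \<subseteq> (\<Union>i. path_image (g i))"
  shows "curve_measure C E \<le> (\<Sum>i. ennreal (path_length (g i)))"
  unfolding curve_measure_def using assms by (intro INF_lower) auto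

text \<open>Covers of the sets \<open>E n\<close> with excess at most
  \<open>e * (1/2) ^ Suc n\<close> are merged into one sequence through the pairing function; the
  total excess is \<open>e\<close>.\<close>

lemma curve_measure_UN_le:
  fixes E :: "nat \<Rightarrow> (real ^ 2) set"
  shows "curve_measure C (\<Union>n. E n) \<le> (\<Sum>n. curve_measure C (E n))"
proof (rule ennreal_le_epsilon)
  fix e :: real
  assume fin: "(\<Sum>n. curve_measure C (E n)) < top" and e: "0 < e"
  have "\<exists>g :: nat \<Rightarrow> real \<Rightarrow> real ^ 2.
      (\<forall>i. g i C1_differentiable_on {0..1} \<and> path_image (g i) \<subseteq> C) \<and>
      E n \<subseteq> (\<Union>i. path_image (g i)) \<and>
      (\<Sum>i. ennreal (path_length (g i))) \<le> curve_measure C (E n) + ennreal (e * (1/2) ^ Suc n)" for n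
  proof -
    have "curve_measure C (E n) < top"
      using ennreal_suminf_lessD[OF fin] .
    moreover have "0 < ennreal (e * (1/2) ^ Suc n)" using e by simp
    ultimately have "curve_measure C (E n) + 0 < curve_measure C (E n) + ennreal (e * (1/2) ^ Suc n)"
      unfolding ennreal_add_left_cancel_less by simp
    then have "(INF g \<in> {g :: nat \<Rightarrow> real \<Rightarrow> real ^ 2.
                 (\<forall>i. g i C1_differentiable_on {0..1} \<and> path_image (g i) \<subseteq> C) \<and>
                 E n \<subseteq> (\<Union>i. path_image (g i))}.
        \<Sum>i. ennreal (path_length (g i))) < curve_measure C (E n) + ennreal (e * (1/2) ^ Suc n)"
      unfolding curve_measure_def[of C "E n", symmetric] by simp
    then show ?thesis
      unfolding INF_less_iff
    proof (rule bexE)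
      fix g :: "nat \<Rightarrow> real \<Rightarrow> real ^ 2"
      assume "g \<in> {g. (\<forall>i. g i C1_differentiable_on {0..1} \<and> path_image (g i) \<subseteq> C) \<and>
          E n \<subseteq> (\<Union>i. path_image (g i))}"
        and "(\<Sum>i. ennreal (path_length (g i))) < curve_measure C (E n) + ennreal (e * (1/2) ^ Suc n)"
      then show ?thesis by (intro exI[of _ g]) (simp add: less_imp_le)
    qed
  qed
  then have "\<forall>n. \<exists>g :: nat \<Rightarrow> real \<Rightarrow> real ^ 2.
      (\<forall>i. g i C1_differentiable_on {0..1} \<and> path_image (g i) \<subseteq> C) \<and>
      E n \<subseteq> (\<Union>i. path_image (g i)) \<and>
      (\<Sum>i. ennreal (path_length (g i))) \<le> curve_measure C (E n) + ennreal (e * (1/2) ^ Suc n)"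
    by (rule allI)
  from choice[OF this] obtain g :: "nat \<Rightarrow> nat \<Rightarrow> real \<Rightarrow> real ^ 2" where
    "\<forall>n. (\<forall>i. g n i C1_differentiable_on {0..1} \<and> path_image (g n i) \<subseteq> C) \<and>
      E n \<subseteq> (\<Union>i. path_image (g n i)) \<and>
      (\<Sum>i. ennreal (path_length (g n i))) \<le> curve_measure C (E n) + ennreal (e * (1/2) ^ Suc n)" ..
  then have g: "\<And>n i. g n i C1_differentiable_on {0..1}" "\<And>n i. path_image (g n i) \<subseteq> C"
      "\<And>n. E n \<subseteq> (\<Union>i. path_image (g n i))"
      "\<And>n. (\<Sum>i. ennreal (path_length (g n i))) \<le> curve_measure C (E n) + ennreal (e * (1/2) ^ Suc n)"
    by simp_all
  define h where "h k = (case prod_decode k of (n, i) \<Rightarrow> g n i)" for k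
  have h: "h (prod_encode (n, i)) = g n i" for n i by (simp add: h_def)
  have "curve_measure C (\<Union>n. E n) \<le> (\<Sum>k. ennreal (path_length (h k)))"
  proof (rule curve_measure_le)
    show "(\<Union>n. E n) \<subseteq> (\<Union>k. path_image (h k))"
    proof (rule UN_least)
      fix n
      have "(\<Union>i. path_image (g n i)) \<subseteq> (\<Union>k. path_image (h k))"
        by (rule UN_least) (metis UN_upper UNIV_I h)
      with g(3)[of n] show "E n \<subseteq> (\<Union>k. path_image (h k))" by (rule order_trans)
    qed
  qed (simp_all add: h_def split_beta g)
  also have "\<dots> = (\<Sum>n. \<Sum>i. ennreal (path_length (g n i)))"
    unfolding h_def split_beta
    using suminf_ennreal_2dimen[where f="\<lambda>p. ennreal (path_length (g (fst p) (snd p)))", OF refl]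
    by simp
  also have "\<dots> \<le> (\<Sum>n. curve_measure C (E n) + ennreal (e * (1/2) ^ Suc n))"
    using g(4) by (intro suminf_le) auto
  also have "\<dots> = (\<Sum>n. curve_measure C (E n)) + (\<Sum>n. ennreal (e * (1/2) ^ Suc n))"
    by (intro suminf_add[symmetric]) auto
  also have "(\<Sum>n. ennreal (e * (1/2) ^ Suc n)) = ennreal e"
    using sums_mult[OF power_half_series, of e] e
    by (intro sums_unique[symmetric] sums_ennreal[THEN iffD2]) auto
  finally show "curve_measure C (\<Union>n. E n) \<le> (\<Sum>n. curve_measure C (E n)) + ennreal e" .
qed

lemma path_length_const: "path_length (\<lambda>_. p) = 0"
  by (simp add: path_length_def)

lemma curve_measure_path_image_le:
  assumes "g C1_differentiable_on {0..1}" "path_image g \<subseteq> C"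
  shows "curve_measure C (path_image g) \<le> ennreal (path_length g)"
proof -
  \<comment> \<open>A single path becomes a sequence by padding with constant paths, which have
    length 0.\<close>
  have "curve_measure C (path_image g) \<le> (\<Sum>i. ennreal (path_length (if i = (0::nat) then g else (\<lambda>_. g 0))))"
    using assms by (intro curve_measure_le) (auto simp: path_image_def split: if_splits)
  also have "\<dots> = ennreal (path_length g)"
    by (subst suminf_finite[of "{0}"]) (auto simp: path_length_const)
  finally show ?thesis .
qed

lemma curve_measure_singleton: "p \<in> C \<Longrightarrow> curve_measure C {p} = 0"
  using curve_measure_path_image_le[of "\<lambda>_. p" C]
  by (simp add: path_image_def path_length_const image_constant_conv)

text \<open>For empty \<open>C\<close> there is no path in \<open>C\<close>, hence no admissible
  cover, and the infimum would be infinite. This is why nonemptiness is carried along below.\<close>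

lemma curve_measure_empty: "C \<noteq> {} \<Longrightarrow> curve_measure C {} = 0"
  using curve_measure_mono[of "{}"] curve_measure_singleton by (metis all_not_in_conv empty_subsetI le_zero_eq)

lemma curve_measure_countable_UN_null:
  assumes "C \<noteq> {}" "countable I" "\<And>i. i \<in> I \<Longrightarrow> curve_measure C (E i) = 0"
  shows "curve_measure C (\<Union>i\<in>I. E i) = 0"
proof (cases "I = {}")
  case True
  then show ?thesis using assms by (simp add: curve_measure_empty)
next
  case False
  have "curve_measure C (\<Union>n. E (from_nat_into I n)) \<le> (\<Sum>n. curve_measure C (E (from_nat_into I n)))"
    by (rule curve_measure_UN_le)
  also have "\<dots> = 0" using assms(3) from_nat_into[OF False] by simp
  also have "(\<Union>n. E (from_nat_into I n)) = (\<Union>i\<in>I. E i)"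
    using range_from_nat_into[OF False assms(2)] by (metis image_image)
  finally show ?thesis by simp
qed

lemma curve_measure_Un_le:
  assumes "C \<noteq> {}"
  shows "curve_measure C (E \<union> F) \<le> curve_measure C E + curve_measure C F"
proof -
  let ?S = "\<lambda>n::nat. if n = 0 then E else if n = 1 then F else {}"
  have "curve_measure C (\<Union>n. ?S n) \<le> (\<Sum>n. curve_measure C (?S n))"
    by (rule curve_measure_UN_le)
  also have "(\<Union>n. ?S n) = E \<union> F" by (auto split: if_splits)
  also have "(\<Sum>n. curve_measure C (?S n)) = curve_measure C E + curve_measure C F"
    by (subst suminf_finite[of "{0, 1}"]) (auto simp: curve_measure_empty[OF assms])
  finally show ?thesis .
qed

lemma curve_measure_finite_UN_le:
  assumes "C \<noteq> {}" "finite I"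
  shows "curve_measure C (\<Union>i\<in>I. E i) \<le> (\<Sum>i\<in>I. curve_measure C (E i))"
  using assms(2)
proof induction
  case empty
  then show ?case using assms by (simp add: curve_measure_empty)
next
  case (insert x F)
  then show ?case
    using order_trans[OF curve_measure_Un_le[OF assms(1), of "E x" "\<Union>i\<in>F. E i"] add_left_mono]
    by auto
qed

text \<open>After an affine change of parameter to \<open>{0..1}\<close> the arc is one admissible
  path, and its length is the integral of a speed bounded by \<open>L * (r - l)\<close>.\<close>

lemma curve_measure_arc_le:
  fixes \<gamma> \<gamma>' :: "real \<Rightarrow> real ^ 2"
  assumes lr: "l \<le> r" and der: "\<And>t. t \<in> {l..r} \<Longrightarrow> (\<gamma> has_vector_derivative \<gamma>' t) (at t)"
    and cont: "continuous_on {l..r} \<gamma>'" and L: "\<And>t. t \<in> {l..r} \<Longrightarrow> norm (\<gamma>' t) \<le> L"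
    and C: "\<gamma> ` {l..r} \<subseteq> C"
  shows "curve_measure C (\<gamma> ` {l..r}) \<le> ennreal (L * (r - l))"
proof -
  define \<phi> where "\<phi> u = l + (r - l) * u" for u :: real
  have \<phi>: "\<phi> u \<in> {l..r}" if "u \<in> {0..1}" for u
    using that lr mult_left_le[of u "r - l"] by (auto simp: \<phi>_def)
  have img: "\<phi> ` {0..1} = {l..r}"
    using lr image_affinity_atLeastAtMost[of "r - l" l 0 1]
    unfolding \<phi>_def add.commute[of l] by simp
  define g where "g = \<gamma> \<circ> \<phi>"
  have gder: "(g has_vector_derivative (r - l) *\<^sub>R \<gamma>' (\<phi> u)) (at u)" if "u \<in> {0..1}" for u
    unfolding g_def
  proof (rule vector_diff_chain_at)
    show "(\<phi> has_vector_derivative (r - l)) (at u)"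
      unfolding \<phi>_def by (auto intro!: derivative_eq_intros)
  qed (use der \<phi> that in auto)
  have cd: "continuous_on {0..1} (\<lambda>u. (r - l) *\<^sub>R \<gamma>' (\<phi> u))"
  proof (rule continuous_on_scaleR[OF continuous_on_const continuous_on_compose2[OF cont]])
    show "continuous_on {0..1} \<phi>" unfolding \<phi>_def by (intro continuous_intros)
  qed (simp add: img)
  have "g C1_differentiable_on {0..1}"
    unfolding C1_differentiable_on_def
    by (rule exI[of _ "\<lambda>u. (r - l) *\<^sub>R \<gamma>' (\<phi> u)"]) (simp add: gder cd)
  moreover have pi: "path_image g = \<gamma> ` {l..r}"
    unfolding path_image_def g_def by (metis image_comp img)
  ultimately have le: "curve_measure C (\<gamma> ` {l..r}) \<le> ennreal (path_length g)"
    using curve_measure_path_image_le[of g C] C by simp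
  have "path_length g = integral {0..1} (\<lambda>u. norm ((r - l) *\<^sub>R \<gamma>' (\<phi> u)))"
    unfolding path_length_def     by (rule integral_cong) (simp only: vector_derivative_at[OF gder])
  also have "\<dots> \<le> integral {0..1} (\<lambda>u :: real. L * (r - l))"
  proof (rule integral_le)
    show "(\<lambda>u. norm ((r - l) *\<^sub>R \<gamma>' (\<phi> u))) integrable_on {0..1}"
      by (intro integrable_continuous_real continuous_on_norm cd)
    show "norm ((r - l) *\<^sub>R \<gamma>' (\<phi> u)) \<le> L * (r - l)" if "u \<in> {0..1}" for u
      using mult_right_mono[OF L[OF \<phi>[OF that]], of "r - l"] lr by (simp add: mult.commute[of "r - l"])
  qed (rule integrable_const_ivl)
  also have "\<dots> = L * (r - l)" by simp
  finally show ?thesis using le ennreal_leI order_trans by blast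
qed

section \<open>Borel--Cantelli on an arc\<close>

text \<open>The point (l, l t, l t^2) lies exactly on the cone, so x^2 - a b has only terms linear
  and quadratic in the errors \<open>f0\<close>, \<open>f1\<close>, \<open>f2\<close>. In a
  quadratic term one factor is bounded by N \<delta> \<le> N, so the estimate stays linear in
  \<delta>. The assumption \<open>l \<ge> 2 * N\<close> makes \<open>a\<close> and \<open>l\<close>
  comparable.\<close>

lemma near_square_perturb:
  fixes l t f0 f1 f2 N \<tau> \<delta> :: real
  assumes l: "l \<ge> 1" "l \<ge> 2 * N" and t: "\<bar>t\<bar> \<le> \<tau>" and \<delta>: "0 < \<delta>" "\<delta> \<le> 1" and N: "N \<ge> 0"
    and f: "\<bar>f0\<bar> \<le> N * \<delta>" "\<bar>f1\<bar> \<le> N * \<delta>" "\<bar>f2\<bar> \<le> N * \<delta>"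
  defines "a \<equiv> l - f0" and "x \<equiv> l * t - f1" and "b \<equiv> l * t\<^sup>2 - f2"
  shows "0 < a" "a \<le> 2 * l" "\<bar>x\<bar> \<le> (2 * \<tau> + 1) * a"
    "\<bar>x\<^sup>2 - a * b\<bar> \<le> 2 * (N * (1 + \<tau>)\<^sup>2 + 2 * N\<^sup>2) * \<delta> * a"
proof -
  have N\<delta>: "N * \<delta> \<le> N" using N \<delta> by (simp add: mult_left_le)
  have la: "l \<le> 2 * a" using f(1) N\<delta> l(2) by (simp add: a_def)
  show "0 < a" "a \<le> 2 * l" using la l f(1) N\<delta> by (auto simp: a_def)
  have \<tau>: "\<tau> \<ge> 0" using t by linarith
  have "\<bar>x\<bar> \<le> \<bar>l * t\<bar> + \<bar>f1\<bar>" unfolding x_def by linarith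
  also have "\<dots> \<le> l * \<tau> + l / 2"
    using f(2) N\<delta> l t by (intro add_mono) (auto simp: abs_mult)
  also have "\<dots> = (\<tau> + 1/2) * l" by (simp add: algebra_simps)
  also have "\<dots> \<le> (\<tau> + 1/2) * (2 * a)" using la \<tau> by (intro mult_left_mono) auto
  finally show "\<bar>x\<bar> \<le> (2 * \<tau> + 1) * a" by (simp add: algebra_simps)
  have "x\<^sup>2 - a * b = - (2 * (l * (t * f1))) + f1 * f1 + l * f2 + l * (t\<^sup>2 * f0) - f0 * f2"
    unfolding x_def a_def b_def by (simp add: algebra_simps power2_eq_square)
  also have "\<bar>\<dots>\<bar> \<le> 2 * \<bar>l * (t * f1)\<bar> + \<bar>f1 * f1\<bar> + \<bar>l * f2\<bar> + \<bar>l * (t\<^sup>2 * f0)\<bar> + \<bar>f0 * f2\<bar>"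
    by linarith
  also have "\<dots> \<le> 2 * (l * (\<tau> * (N * \<delta>))) + l * (N * (N * \<delta>)) + l * (N * \<delta>) + l * (\<tau>\<^sup>2 * (N * \<delta>))
      + l * (N * (N * \<delta>))"
  proof -
    have sq: "t\<^sup>2 \<le> \<tau>\<^sup>2" using t by (metis abs_ge_zero power2_abs power_mono)
    have ff: "\<bar>u * v\<bar> \<le> l * (N * (N * \<delta>))" if "\<bar>u\<bar> \<le> N * \<delta>" "\<bar>v\<bar> \<le> N * \<delta>" for u v
    proof -
      have "\<bar>u * v\<bar> \<le> N * (N * \<delta>)"
        unfolding abs_mult using that N\<delta> N \<delta> by (intro mult_mono) auto
      also have "\<dots> \<le> l * (N * (N * \<delta>))"
        using l N \<delta> mult_right_mono[of 1 l "N * (N * \<delta>)"] by simp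
      finally show ?thesis .
    qed
    have "\<bar>l * (t * f1)\<bar> \<le> l * (\<tau> * (N * \<delta>))" "\<bar>l * f2\<bar> \<le> l * (N * \<delta>)"
      "\<bar>l * (t\<^sup>2 * f0)\<bar> \<le> l * (\<tau>\<^sup>2 * (N * \<delta>))"
      unfolding abs_mult using l t f sq \<tau> N \<delta> by (auto intro!: mult_mono)
    then show ?thesis using ff[OF f(2) f(2)] ff[OF f(1) f(3)] by linarith
  qed
  also have "\<dots> = (N * (1 + \<tau>)\<^sup>2 + 2 * N\<^sup>2) * \<delta> * l"
    by (simp add: algebra_simps power2_eq_square)
  also have "\<dots> \<le> (N * (1 + \<tau>)\<^sup>2 + 2 * N\<^sup>2) * \<delta> * (2 * a)"
    using la N \<delta> by (intro mult_left_mono) auto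
  finally show "\<bar>x\<^sup>2 - a * b\<bar> \<le> 2 * (N * (1 + \<tau>)\<^sup>2 + 2 * N\<^sup>2) * \<delta> * a"
    by (simp add: mult_ac)
qed

section \<open>Dyadic splitting of the product condition and condensation of the series\<close>

lemma dist_int_nonneg: "0 \<le> dist_int x"
  using dist_int_attained[of x] by auto

lemma dist_int_le_1: "dist_int x \<le> 1"
  using dist_int_le[of x "\<lfloor>x\<rfloor>"] by linarith

text \<open>In general \<open>k\<close> locates \<open>d1\<close> between
  \<open>(1/2) ^ Suc k\<close> and \<open>(1/2) ^ k\<close>, and the product condition then bounds
  \<open>d2\<close>. The lower bound on \<Psi> caps \<open>k\<close>: once \<open>d1\<close> is at
  most \<open>(1/2) ^ (2 * j)\<close>, the choice \<open>k = 2 * j\<close> leaves only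
  \<open>d2 \<le> 1\<close> to satisfy.\<close>

lemma dyadic_split:
  fixes d1 d2 \<Psi> :: real
  assumes d: "0 \<le> d1" "d1 \<le> 1" "0 \<le> d2" "d2 \<le> 1" and lt: "d1 * d2 < \<Psi>"
    and \<Psi>: "(1/2) ^ (2 * j) \<le> \<Psi>"
  shows "\<exists>k\<le>2 * j. d1 \<le> (1/2) ^ k \<and> d2 \<le> min 1 (2 * 2 ^ k * \<Psi>)"
proof (cases "d1 \<le> (1/2) ^ (2 * j)")
  case True
  have "2 ^ (2 * j) * ((1/2) ^ (2 * j)) \<le> 2 ^ (2 * j) * \<Psi>" using \<Psi> by (intro mult_left_mono) auto
  moreover have "(2::real) ^ (2 * j) * ((1/2) ^ (2 * j)) = 1" by (simp add: power_divide)
  ultimately show ?thesis using True d by (intro exI[of _ "2 * j"]) auto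
next
  case False
  define k where "k = (LEAST k. (1/2) ^ Suc k < d1)"
  have ex: "(1/2) ^ Suc (2 * j) < d1"
  proof -
    have "(1/2::real) ^ Suc (2 * j) \<le> (1/2) ^ (2 * j)" by (intro power_decreasing) auto
    then show ?thesis using False by linarith
  qed
  have k: "(1/2) ^ Suc k < d1" unfolding k_def by (rule LeastI[of _ "2 * j"], rule ex)
  have k2: "k \<le> 2 * j" unfolding k_def by (rule Least_le) (rule ex)
  have k3: "d1 \<le> (1/2) ^ k"
  proof (cases k)
    case (Suc i)
    then have "\<not> (1/2) ^ Suc i < d1" unfolding k_def by (intro not_less_Least) simp
    then show ?thesis using Suc by simp
  qed (use d in simp)
  have "(1/2) ^ Suc k * d2 \<le> d1 * d2" using k d by (intro mult_right_mono) auto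
  then have "(1/2) ^ Suc k * d2 < \<Psi>" using lt by linarith
  then have "d2 \<le> 2 * 2 ^ k * \<Psi>" by (simp add: field_simps power_divide)
  then show ?thesis using k2 k3 d by auto
qed

text \<open>Cauchy condensation: on the block from \<open>2 ^ n\<close> to \<open>2 ^ Suc n\<close>
  the logarithm is at least \<open>n * ln 2\<close>, and \<psi> is at least its value at the right
  end. The weight \<open>2 * j + 1\<close> is the number of boxes with
  \<open>k \<le> 2 * j\<close>.\<close>

lemma summable_dyadic:
  assumes \<psi>: "approximating_function \<psi>"
    and sum: "summable (\<lambda>n. \<psi> (real (Suc n)) * ln (real (Suc n)))"
  shows "summable (\<lambda>j. (2 * real j + 1) * (2 ^ j * \<psi> (2 ^ j)))"
proof -
  define f where "f n = \<psi> (real n) * ln (real n)" for n :: nat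
  have \<psi>pos: "\<psi> x > 0" if "x > 0" for x using \<psi> that by (simp add: approximating_function_def)
  have mono: "\<psi> y \<le> \<psi> x" if "0 < x" "x \<le> y" for x y
    using \<psi> that by (auto simp: approximating_function_def monotone_on_def)
  have f0: "f n \<ge> 0" if "n > 0" for n using \<psi>pos[of n] that by (simp add: f_def)
  have partial: "(\<Sum>j<n. real j * ln 2 * (2 ^ j * \<psi> (2 ^ Suc j))) \<le> (\<Sum>i\<in>{0<..2 ^ n}. f i)" for n :: nat
  proof (induction n)
    case 0
    have "{0<..1::nat} = {1}" by auto
    then show ?case using f0[of 1] by simp
  next
    case (Suc n)
    have "real n * ln 2 * (2 ^ n * \<psi> (2 ^ Suc n)) = (\<Sum>i\<in>{2 ^ n<..(2::nat) ^ Suc n}. \<psi> (2 ^ Suc n) * (real n * ln 2))"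
      by simp
    also have "\<dots> \<le> (\<Sum>i\<in>{2 ^ n<..2 ^ Suc n}. f i)"
      unfolding f_def
    proof (intro sum_mono mult_mono)
      fix i :: nat assume i: "i \<in> {2 ^ n<..2 ^ Suc n}"
      have "real i \<le> real (2 ^ Suc n)" "real (2 ^ n) \<le> real i" "i > 0"
        using i by (auto simp only: of_nat_le_iff greaterThanAtMost_iff intro: less_imp_le)
      then have i': "real i \<le> 2 ^ Suc n" "2 ^ n \<le> real i" "real i > 0" by auto
      show "\<psi> (2 ^ Suc n) \<le> \<psi> (real i)" using i' by (intro mono) auto
      have "real n * ln 2 = ln (2 ^ n)" by (simp add: ln_realpow)
      also have "\<dots> \<le> ln (real i)" using i' by (subst ln_le_cancel_iff) auto
      finally show "real n * ln 2 \<le> ln (real i)" .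
      show "0 \<le> \<psi> (real i)" using \<psi>pos[OF i'(3)] by simp
    qed simp
    finally have "real n * ln 2 * (2 ^ n * \<psi> (2 ^ Suc n)) \<le> (\<Sum>i\<in>{2 ^ n<..2 ^ Suc n}. f i)" .
    moreover have "{0<..(2::nat) ^ Suc n} = {0<..2 ^ n} \<union> {2 ^ n<..2 ^ Suc n}" by auto
    then have "(\<Sum>i\<in>{0<..2 ^ Suc n}. f i) = (\<Sum>i\<in>{0<..2 ^ n}. f i) + (\<Sum>i\<in>{2 ^ n<..2 ^ Suc n}. f i)"
      by (simp only:) (rule sum.union_disjoint, auto)
    ultimately show ?case using Suc.IH by simp
  qed
  have total: "(\<Sum>i\<in>{0<..N}. f i) \<le> (\<Sum>n. f (Suc n))" for N
  proof -
    have "(\<Sum>i\<in>{0<..N}. f i) = (\<Sum>i<N. f (Suc i))"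
      by (rule sum.reindex_bij_witness[of _ Suc "\<lambda>i. i - 1"]) auto
    also have "\<dots> \<le> (\<Sum>n. f (Suc n))"
    proof (rule sum_le_suminf)
      show "summable (\<lambda>n. f (Suc n))" using sum by (simp add: f_def)
    qed (use f0 in auto)
    finally show ?thesis .
  qed
  have "summable (\<lambda>j. real j * ln 2 * (2 ^ j * \<psi> (2 ^ Suc j)))"
  proof (rule summableI_nonneg_bounded)
    show "0 \<le> real j * ln 2 * (2 ^ j * \<psi> (2 ^ Suc j))" for j
      using \<psi>pos[of "2 ^ Suc j"] by simp
    show "(\<Sum>j<n. real j * ln 2 * (2 ^ j * \<psi> (2 ^ Suc j))) \<le> (\<Sum>n. f (Suc n))" for n
      using order_trans[OF partial total] .
  qed
  \<comment> \<open>After the shift by one the weight is 2 (2 j + 3) = 4 j + 6, which is at most 10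
    j from \<open>j = 1\<close> on; the division cancels the factor \<open>ln 2\<close> of the
    series at hand.\<close>
  then have "summable (\<lambda>j. 10 / ln 2 * (real j * ln 2 * (2 ^ j * \<psi> (2 ^ Suc j))))"
    by (rule summable_mult)
  then have "summable (\<lambda>j. (2 * real (Suc j) + 1) * (2 ^ Suc j * \<psi> (2 ^ Suc j)))"
  proof (rule summable_comparison_test_ev[rotated])
    show "\<forall>\<^sub>F j in sequentially. norm ((2 * real (Suc j) + 1) * (2 ^ Suc j * \<psi> (2 ^ Suc j)))
        \<le> 10 / ln 2 * (real j * ln 2 * (2 ^ j * \<psi> (2 ^ Suc j)))"
    proof (rule eventually_sequentiallyI)
      fix j :: nat assume j: "1 \<le> j"
      have p: "2 ^ j * \<psi> (2 ^ Suc j) \<ge> 0" using \<psi>pos[of "2 ^ Suc j"] by simp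
      have "norm ((2 * real (Suc j) + 1) * (2 ^ Suc j * \<psi> (2 ^ Suc j))) =
          (4 * real j + 6) * (2 ^ j * \<psi> (2 ^ Suc j))"
        using \<psi>pos[of "2 ^ Suc j"] by (simp add: abs_mult algebra_simps)
      also have "\<dots> \<le> (10 * real j) * (2 ^ j * \<psi> (2 ^ Suc j))"
        using j p by (intro mult_right_mono) auto
      finally show "norm ((2 * real (Suc j) + 1) * (2 ^ Suc j * \<psi> (2 ^ Suc j)))
        \<le> 10 / ln 2 * (real j * ln 2 * (2 ^ j * \<psi> (2 ^ Suc j)))" by simp
    qed
  qed
  then show ?thesis
    using summable_Suc_iff[of "\<lambda>j. (2 * real j + 1) * (2 ^ j * \<psi> (2 ^ j))"] by simp
qed

text \<open>The first series comes from the \<open>(1/2) ^ (2 * j)\<close> that will be added to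
  \<open>\<psi> (2 ^ j)\<close>, the second from the lower-order term of the count. Comparing with
  ratio 3/4 instead of 1/2 leaves room for the polynomial factors.\<close>

lemma summable_dyadic_remainder:
  "summable (\<lambda>j. (2 * real j + 1) * 2 ^ j * (1/2) ^ (2 * j))"
  "summable (\<lambda>j. (2 * real j + 1) * ((1 + real j) ^ 4 / 2 ^ j))"
proof -
  show "summable (\<lambda>j. (2 * real j + 1) * 2 ^ j * (1/2) ^ (2 * j))"
  proof (rule summable_comparison_test_bigo)
    show "summable (\<lambda>j. norm ((3/4 :: real) ^ j))" by simp
    have "2 ^ j * (1/2) ^ (2 * j) = (1/2 :: real) ^ j" for j
      by (simp add: mult_2 power_add power_divide)
    then show "(\<lambda>j. (2 * real j + 1) * 2 ^ j * (1/2) ^ (2 * j)) \<in> O(\<lambda>j. (3/4 :: real) ^ j)"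
      unfolding mult.assoc by simp real_asymp
  qed
  show "summable (\<lambda>j. (2 * real j + 1) * ((1 + real j) ^ 4 / 2 ^ j))"
  proof (rule summable_comparison_test_bigo)
    show "summable (\<lambda>j. norm ((3/4 :: real) ^ j))" by simp
    have "(1 + real j) ^ 4 / 2 ^ j = (1 + real j) ^ 4 * (1/2) ^ j" for j
      by (simp add: power_divide)
    then show "(\<lambda>j. (2 * real j + 1) * ((1 + real j) ^ 4 / 2 ^ j)) \<in> O(\<lambda>j. (3/4 :: real) ^ j)"
      by simp real_asymp
  qed
qed

section \<open>Approximation on a single compact arc\<close>

text \<open>\<open>H\<close> sends (\<open>\<gamma> t\<close>, 1) to the cone point with parameter
  \<open>t\<close> and scale \<open>\<mu> t\<close>, and \<open>m\<close>, \<open>M\<close> keep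
  that scale away from 0 and infinity. The constant \<open>c\<close> bounds the expansion of both
  coordinates from below, so either coordinate alone localises \<open>t\<close>; this is the source
  of \<open>min e1 e2\<close> later.\<close>

locale conic_arc =
  fixes C :: "(real ^ 2) set" and \<gamma> \<gamma>' :: "real \<Rightarrow> real ^ 2" and \<alpha> \<beta> :: real
    and H :: "int ^ 3 ^ 3" and \<mu> :: "real \<Rightarrow> real" and c L m M :: real
  assumes \<gamma>': "\<And>t. t \<in> {\<alpha>..\<beta>} \<Longrightarrow> (\<gamma> has_vector_derivative \<gamma>' t) (at t)"
    and cont: "continuous_on {\<alpha>..\<beta>} \<gamma>'"
    and L: "\<And>t. t \<in> {\<alpha>..\<beta>} \<Longrightarrow> norm (\<gamma>' t) \<le> L"
    and C: "\<gamma> ` {\<alpha>..\<beta>} \<subseteq> C" and C_ne: "C \<noteq> {}"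
    and c: "c > 0" "\<And>s t i. s \<in> {\<alpha>..\<beta>} \<Longrightarrow> t \<in> {\<alpha>..\<beta>} \<Longrightarrow> c * \<bar>s - t\<bar> \<le> \<bar>\<gamma> s $ i - \<gamma> t $ i\<bar>"
    and H: "\<And>t. t \<in> {\<alpha>..\<beta>} \<Longrightarrow> map_matrix of_int H *v vector [\<gamma> t $ 1, \<gamma> t $ 2, 1] =
        vector [\<mu> t, \<mu> t * t, \<mu> t * t\<^sup>2]"
    and \<mu>: "m > 0" "\<And>t. t \<in> {\<alpha>..\<beta>} \<Longrightarrow> m \<le> \<mu> t \<and> \<mu> t \<le> M"
    and inj: "inj ((*v) H)"
begin

text \<open>\<open>v\<close> encodes (p1, p2, q) with the common denominator last, matching the
  homogeneous coordinates (y1, y2, 1).\<close>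

definition near :: "real \<Rightarrow> real \<Rightarrow> int ^ 3 \<Rightarrow> real set" where
  "near e1 e2 v = {t \<in> {\<alpha>..\<beta>}. \<bar>v $ 3 * \<gamma> t $ 1 - v $ 1\<bar> \<le> e1 \<and> \<bar>v $ 3 * \<gamma> t $ 2 - v $ 2\<bar> \<le> e2}"

definition nearby :: "real \<Rightarrow> real \<Rightarrow> real \<Rightarrow> (int ^ 3) set" where
  "nearby Q e1 e2 = {v. Q \<le> real_of_int (v $ 3) \<and> real_of_int (v $ 3) < 2 * Q \<and> near e1 e2 v \<noteq> {}}"

lemma nearby_code:
  "\<exists>Q0\<ge>1. \<exists>A0\<ge>1. \<exists>B\<ge>0. \<exists>D>0. \<forall>Q\<ge>Q0. \<forall>e1\<in>{0<..1}. \<forall>e2\<in>{0<..1}. \<forall>v\<in>nearby Q e1 e2.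
    ((H *v v) $ 1, (H *v v) $ 2, (H *v v) $ 3) \<in> near_squares (A0 * Q) B (D * max e1 e2)"
proof -
  define N where "N = (\<Sum>i\<in>UNIV. \<Sum>j\<in>UNIV. \<bar>real_of_int (H $ i $ j)\<bar>) + 1"
  have N_row: "\<bar>real_of_int (H $ i $ 1)\<bar> + \<bar>real_of_int (H $ i $ 2)\<bar> \<le> N" for i
  proof -
    have "\<bar>real_of_int (H $ i $ 1)\<bar> + \<bar>real_of_int (H $ i $ 2)\<bar> \<le> (\<Sum>j\<in>UNIV. \<bar>real_of_int (H $ i $ j)\<bar>)"
      by (simp add: sum_3)
    also have "\<dots> \<le> (\<Sum>i\<in>UNIV. \<Sum>j\<in>UNIV. \<bar>real_of_int (H $ i $ j)\<bar>)"
      by (rule member_le_sum) (auto intro: sum_nonneg)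
    finally show ?thesis by (simp add: N_def)
  qed
  have N1: "N \<ge> 1" unfolding N_def by (simp add: sum_nonneg)
  define \<tau> where "\<tau> = max \<bar>\<alpha>\<bar> \<bar>\<beta>\<bar>"
  have \<tau>: "\<tau> \<ge> 0" by (simp add: \<tau>_def)
  \<comment> \<open>\<open>Q0\<close> guarantees q \<mu>(t) \<ge> 2 N, as
    \<open>near_square_perturb\<close> demands, and \<open>A0\<close> comes from a \<le> 2 l \<le> 4
    M Q.\<close>
  define Q0 where "Q0 = max 1 (2 * N / m)"
  define A0 where "A0 = max 1 (4 * M)"
  define D where "D = 2 * (N * (1 + \<tau>)\<^sup>2 + 2 * N\<^sup>2)"
  have D: "D > 0" using N1 by (simp add: D_def add_nonneg_pos)
  have "((H *v v) $ 1, (H *v v) $ 2, (H *v v) $ 3) \<in> near_squares (A0 * Q) (2 * \<tau> + 1) (D * max e1 e2)"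
    if Q: "Q \<ge> Q0" and e1: "e1 \<in> {0<..1}" and e2: "e2 \<in> {0<..1}" and v: "v \<in> nearby Q e1 e2"
    for Q e1 e2 v
  proof -
    obtain t where t: "t \<in> {\<alpha>..\<beta>}" and d1: "\<bar>v $ 3 * \<gamma> t $ 1 - v $ 1\<bar> \<le> e1"
      and d2: "\<bar>v $ 3 * \<gamma> t $ 2 - v $ 2\<bar> \<le> e2"
      using v by (auto simp: nearby_def near_def)
    have q: "Q \<le> real_of_int (v $ 3)" "real_of_int (v $ 3) < 2 * Q" using v by (auto simp: nearby_def)
    have Q1: "Q \<ge> 1" "2 * N / m \<le> Q" using Q by (auto simp: Q0_def)
    define l where "l = real_of_int (v $ 3) * \<mu> t"
    have "2 * N \<le> Q * m" using Q1(2) \<mu>(1) by (simp add: field_simps)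
    also have "\<dots> \<le> l" unfolding l_def using q Q1 \<mu>(1) \<mu>(2)[OF t] by (intro mult_mono) auto
    finally have l2: "2 * N \<le> l" .
    have "l \<le> (2 * Q) * M"
      unfolding l_def using q Q1 \<mu>(1) \<mu>(2)[OF t] by (intro mult_mono) auto
    moreover have "4 * M * Q \<le> A0 * Q" using Q1 by (intro mult_right_mono) (auto simp: A0_def)
    ultimately have lM: "2 * l \<le> A0 * Q" by (simp add: mult_ac)
    define \<delta> where "\<delta> = max e1 e2"
    have \<delta>: "0 < \<delta>" "\<delta> \<le> 1" "e1 \<le> \<delta>" "e2 \<le> \<delta>" using e1 e2 by (auto simp: \<delta>_def)
    \<comment> \<open>The image under \<open>H\<close> of the difference between q
      (\<open>\<gamma> t\<close>, 1) and \<open>v\<close>. The last coordinates agree exactly, so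
      only the first two columns of \<open>H\<close> occur.\<close>
    define f where "f i = real_of_int (H $ i $ 1) * (v $ 3 * \<gamma> t $ 1 - v $ 1)
        + real_of_int (H $ i $ 2) * (v $ 3 * \<gamma> t $ 2 - v $ 2)" for i
    have f: "\<bar>f i\<bar> \<le> N * \<delta>" for i
    proof -
      have "\<bar>f i\<bar> \<le> \<bar>real_of_int (H $ i $ 1)\<bar> * \<bar>v $ 3 * \<gamma> t $ 1 - v $ 1\<bar>
        + \<bar>real_of_int (H $ i $ 2)\<bar> * \<bar>v $ 3 * \<gamma> t $ 2 - v $ 2\<bar>"
        unfolding f_def abs_mult[symmetric] by (rule abs_triangle_ineq)
      also have "\<dots> \<le> \<bar>real_of_int (H $ i $ 1)\<bar> * \<delta> + \<bar>real_of_int (H $ i $ 2)\<bar> * \<delta>"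
        using d1 d2 \<delta> by (intro add_mono mult_left_mono) auto
      also have "\<dots> = (\<bar>real_of_int (H $ i $ 1)\<bar> + \<bar>real_of_int (H $ i $ 2)\<bar>) * \<delta>"
        by (simp add: algebra_simps)
      also have "\<dots> \<le> N * \<delta>" using N_row \<delta> by (intro mult_right_mono) auto
      finally show ?thesis .
    qed
    have Hr: "real_of_int (H $ i $ 1) * \<gamma> t $ 1 + real_of_int (H $ i $ 2) * \<gamma> t $ 2 + real_of_int (H $ i $ 3)
        = (vector [\<mu> t, \<mu> t * t, \<mu> t * t\<^sup>2] :: real ^ 3) $ i" for i
      using H[OF t, THEN arg_cong, of "\<lambda>z. z $ i"]
      by (simp add: matrix_vector_mult_def sum_3 vector_3)
    have z: "real_of_int ((H *v v) $ i) =
        v $ 3 * (vector [\<mu> t, \<mu> t * t, \<mu> t * t\<^sup>2] :: real ^ 3) $ i - f i" for i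
      unfolding Hr[symmetric] f_def by (simp add: matrix_vector_mult_def sum_3 algebra_simps)
    have z': "real_of_int ((H *v v) $ 1) = l - f 1" "real_of_int ((H *v v) $ 2) = l * t - f 2"
      "real_of_int ((H *v v) $ 3) = l * t\<^sup>2 - f 3"
      unfolding z by (simp_all add: l_def vector_3)
    have "\<bar>t\<bar> \<le> \<tau>" using t by (auto simp: \<tau>_def)
    note * = near_square_perturb[OF _ l2 this \<delta>(1,2) _ f[of 1] f[of 2] f[of 3], folded z']
    show ?thesis
      unfolding near_squares_def \<delta>_def[symmetric] D_def
      using * l2 N1 lM by auto
  qed
  then show ?thesis
    using D \<tau> by (intro exI[of _ Q0] conjI exI[of _ A0] exI[of _ "2 * \<tau> + 1"] exI[of _ D])
      (auto simp: Q0_def A0_def)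
qed

text \<open>\<open>H\<close> is injective on integer vectors, so distinct approximations give
  distinct triples and the bound for \<open>near_squares\<close> carries over.\<close>

lemma card_nearby:
  "\<exists>Q0\<ge>1. \<exists>K>0. \<forall>Q\<ge>Q0. \<forall>e1\<in>{0<..1}. \<forall>e2\<in>{0<..1}. finite (nearby Q e1 e2) \<and>
    real (card (nearby Q e1 e2)) \<le> K * (max e1 e2 * Q\<^sup>2 + Q * (1 + ln Q)\<^sup>2)"
proof -
  obtain Q0 A0 B D where Q0: "Q0 \<ge> 1" and A0: "A0 \<ge> 1" and B: "B \<ge> 0" and D: "D > 0" and
    code: "\<And>Q e1 e2 v. \<lbrakk>Q \<ge> Q0; e1 \<in> {0<..1}; e2 \<in> {0<..1}; v \<in> nearby Q e1 e2\<rbrakk> \<Longrightarrow>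
    ((H *v v) $ 1, (H *v v) $ 2, (H *v v) $ 3) \<in> near_squares (A0 * Q) B (D * max e1 e2)"
    using nearby_code by metis
  define K where "K = 3000 * (2 * B + 3) * (D * A0\<^sup>2 + A0 * (1 + ln A0)\<^sup>2)"
  have "2 * B + 3 > 0" "D * A0\<^sup>2 + A0 * (1 + ln A0)\<^sup>2 > 0"
    using B D A0 by (auto intro!: add_pos_nonneg)
  then have K: "K > 0" by (simp add: K_def)
  have "finite (nearby Q e1 e2) \<and>
    real (card (nearby Q e1 e2)) \<le> K * (max e1 e2 * Q\<^sup>2 + Q * (1 + ln Q)\<^sup>2)"
    if Q: "Q \<ge> Q0" and e: "e1 \<in> {0<..1}" "e2 \<in> {0<..1}" for Q e1 e2
  proof -
    let ?\<Phi> = "\<lambda>v. ((H *v v) $ 1, (H *v v) $ 2, (H *v v) $ 3)"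
    let ?T = "near_squares (A0 * Q) B (D * max e1 e2)"
    have Q1: "Q \<ge> 1" using Q Q0 by simp
    have e0: "max e1 e2 > 0" using e by auto
    have "inj_on ?\<Phi> (nearby Q e1 e2)"
    proof (rule inj_onI)
      fix v v' assume "?\<Phi> v = ?\<Phi> v'"
      then have "H *v v = H *v v'" by (simp add: vec_eq_iff forall_3)
      then show "v = v'" using inj by (simp add: inj_eq)
    qed
    moreover have "?\<Phi> ` nearby Q e1 e2 \<subseteq> ?T" using code[OF Q e] by blast
    moreover have A1: "A0 * Q \<ge> 1" using mult_mono[of 1 A0 1 Q] A0 Q1 by simp
    have T: "finite ?T" "real (card ?T) \<le> 3000 * (2 * B + 3) *
        (D * max e1 e2 * (A0 * Q)\<^sup>2 + A0 * Q * (1 + ln (A0 * Q))\<^sup>2)"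
      using card_near_squares[OF A1 _ B] D e0 by auto
    ultimately have fin: "finite (nearby Q e1 e2)" and "card (nearby Q e1 e2) \<le> card ?T"
      using inj_on_finite card_inj_on_le by blast+
    then have "real (card (nearby Q e1 e2)) \<le> 3000 * (2 * B + 3) *
        (D * max e1 e2 * (A0 * Q)\<^sup>2 + A0 * Q * (1 + ln (A0 * Q))\<^sup>2)"
      using T(2) by linarith
    also have "\<dots> \<le> 3000 * (2 * B + 3) *
        (D * max e1 e2 * (A0 * Q)\<^sup>2 + A0 * Q * ((1 + ln A0) * (1 + ln Q))\<^sup>2)"
    proof -
      \<comment> \<open>The right side exceeds the left by \<open>ln A0 * ln Q\<close>, which is
        nonnegative as \<open>A0\<close> and \<open>Q\<close> are at least 1.\<close>
      have "1 + ln (A0 * Q) \<le> (1 + ln A0) * (1 + ln Q)"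
        using A0 Q1 by (simp add: ln_mult algebra_simps)
      then show ?thesis
        using A0 Q1 B A1 by (intro mult_left_mono add_left_mono power_mono) auto
    qed
    also have "\<dots> \<le> K * (max e1 e2 * Q\<^sup>2 + Q * (1 + ln Q)\<^sup>2)"
    proof -
      let ?P = "max e1 e2 * Q\<^sup>2" and ?R = "Q * (1 + ln Q)\<^sup>2"
      have "0 \<le> D * A0\<^sup>2 * ?R + A0 * (1 + ln A0)\<^sup>2 * ?P" using e0 Q1 D A0 by auto
      then have "D * A0\<^sup>2 * ?P + A0 * (1 + ln A0)\<^sup>2 * ?R \<le> (D * A0\<^sup>2 + A0 * (1 + ln A0)\<^sup>2) * (?P + ?R)"
        unfolding distrib_left distrib_right by linarith
      then have "3000 * (2 * B + 3) * (D * A0\<^sup>2 * ?P + A0 * (1 + ln A0)\<^sup>2 * ?R) \<le>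
          3000 * (2 * B + 3) * ((D * A0\<^sup>2 + A0 * (1 + ln A0)\<^sup>2) * (?P + ?R))"
        using B by (intro mult_left_mono) auto
      then show ?thesis unfolding K_def by (simp add: power_mult_distrib mult_ac)
    qed
    finally show ?thesis using fin by blast
  qed
  then show ?thesis using Q0 K by blast
qed

text \<open>At two such times coordinate \<open>i\<close> of \<gamma> differs by at most twice its
  tolerance over \<open>Q\<close>. Expansion in each coordinate separately lets the smaller
  tolerance win, so all times lie within \<open>d\<close> of any one of them, in an interval of
  length at most \<open>2 * d\<close>; hence the factor 4.\<close>

lemma curve_measure_near:
  assumes "Q > 0" "e1 > 0" "e2 > 0" "Q \<le> real_of_int (v $ 3)"
  shows "curve_measure C (\<gamma> ` near e1 e2 v) \<le> ennreal (4 * L / c * (min e1 e2 / Q))"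
proof (cases "near e1 e2 v = {}")
  case True
  then show ?thesis by (simp add: curve_measure_empty C_ne)
next
  case False
  then obtain t0 where t0: "t0 \<in> near e1 e2 v" by blast
  define d where "d = 2 * min e1 e2 / (c * Q)"
  have d: "d > 0" using assms c by (auto simp: d_def)
  have t0J: "t0 \<in> {\<alpha>..\<beta>}" using t0 by (simp add: near_def)
  have dist: "\<bar>t - t0\<bar> \<le> d" if "t \<in> near e1 e2 v" for t
  proof -
    have J: "t \<in> {\<alpha>..\<beta>}" using that by (simp add: near_def)
    have "c * \<bar>t - t0\<bar> * Q \<le> 2 * e" if "\<bar>v $ 3 * \<gamma> t $ i - p\<bar> \<le> e" "\<bar>v $ 3 * \<gamma> t0 $ i - p\<bar> \<le> e" for i p e
    proof -
      have "c * \<bar>t - t0\<bar> * Q \<le> \<bar>\<gamma> t $ i - \<gamma> t0 $ i\<bar> * v $ 3"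
        using c(2)[OF J t0J] assms c(1) by (intro mult_mono) auto
      also have "\<dots> = \<bar>v $ 3 * \<gamma> t $ i - v $ 3 * \<gamma> t0 $ i\<bar>"
        using assms by (simp add: abs_mult right_diff_distrib[symmetric])
      also have "\<dots> \<le> 2 * e" using that by linarith
      finally show ?thesis .
    qed
    from this[of 1 "real_of_int (v $ 1)" e1] this[of 2 "real_of_int (v $ 2)" e2]
    have "c * \<bar>t - t0\<bar> * Q \<le> 2 * min e1 e2"
      using that t0 by (auto simp: near_def)
    then show ?thesis using c assms by (simp add: d_def field_simps)
  qed
  define l r where "l = max \<alpha> (t0 - d)" and "r = min \<beta> (t0 + d)"
  have lr: "l \<le> r" "{l..r} \<subseteq> {\<alpha>..\<beta>}" "r - l \<le> 2 * d" using t0J d by (auto simp: l_def r_def)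
  have L0: "L \<ge> 0" using L[OF t0J] norm_ge_zero order_trans by blast
  have "near e1 e2 v \<subseteq> {l..r}"
  proof
    fix t assume t: "t \<in> near e1 e2 v"
    then have "t \<in> {\<alpha>..\<beta>}" by (simp add: near_def)
    then show "t \<in> {l..r}" using dist[OF t] by (auto simp: l_def r_def)
  qed
  then have "curve_measure C (\<gamma> ` near e1 e2 v) \<le> curve_measure C (\<gamma> ` {l..r})"
    by (intro curve_measure_mono image_mono)
  also have "\<dots> \<le> ennreal (L * (r - l))"
    using lr C by (intro curve_measure_arc_le[where \<gamma>' = \<gamma>'] \<gamma>' L continuous_on_subset[OF cont]) auto
  also have "\<dots> \<le> ennreal (4 * L / c * (min e1 e2 / Q))"
  proof (rule ennreal_leI)
    have "L * (r - l) \<le> L * (2 * d)" using lr L0 by (intro mult_left_mono) auto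
    then show "L * (r - l) \<le> 4 * L / c * (min e1 e2 / Q)" by (simp add: d_def mult_ac)
  qed
  finally show ?thesis .
qed

text \<open>Number of approximations times length of each arc; the leading terms combine through
  \<open>max e1 e2 * min e1 e2 = e1 * e2\<close>.\<close>

lemma curve_measure_nearby:
  "\<exists>Q0\<ge>1. \<exists>K\<ge>0. \<forall>Q\<ge>Q0. \<forall>e1\<in>{0<..1}. \<forall>e2\<in>{0<..1}.
    curve_measure C (\<gamma> ` (\<Union>v\<in>nearby Q e1 e2. near e1 e2 v)) \<le>
    ennreal (K * (Q * (e1 * e2) + (1 + ln Q) ^ 4 / Q))"
proof (cases "\<alpha> \<le> \<beta>")
  case False
  then have "near e1 e2 v = {}" for e1 e2 v by (auto simp: near_def)
  then show ?thesis using C_ne by (auto simp: curve_measure_empty)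
next
  case True
  then have L0: "L \<ge> 0" using L[of \<alpha>] norm_ge_zero[of "\<gamma>' \<alpha>"] by (simp del: norm_ge_zero)
  obtain Q0 K where Q0: "Q0 \<ge> 1" and K: "K > 0" and
    card: "\<And>Q e1 e2. \<lbrakk>Q \<ge> Q0; e1 \<in> {0<..1}; e2 \<in> {0<..1}\<rbrakk> \<Longrightarrow> finite (nearby Q e1 e2) \<and>
      real (card (nearby Q e1 e2)) \<le> K * (max e1 e2 * Q\<^sup>2 + Q * (1 + ln Q)\<^sup>2)"
    using card_nearby by metis
  define K' where "K' = 2 * K * (4 * L / c)"
  have K': "K' \<ge> 0" using K L0 c by (simp add: K'_def)
  have "curve_measure C (\<gamma> ` (\<Union>v\<in>nearby Q e1 e2. near e1 e2 v)) \<le>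
    ennreal (K' * (Q * (e1 * e2) + (1 + ln Q) ^ 4 / Q))"
    if Q: "Q \<ge> Q0" and e: "e1 \<in> {0<..1}" "e2 \<in> {0<..1}" for Q e1 e2
  proof -
    have Q1: "Q \<ge> 1" using Q Q0 by simp
    have e0: "e1 > 0" "e2 > 0" using e by auto
    define h where "h = 1 + ln Q"
    define n where "n = 4 * L / c * (min e1 e2 / Q)"
    have n0: "n \<ge> 0" using L0 c e0 Q1 by (simp add: n_def)
    have fin: "finite (nearby Q e1 e2)" using card[OF Q e] by blast
    have "curve_measure C (\<gamma> ` (\<Union>v\<in>nearby Q e1 e2. near e1 e2 v)) =
        curve_measure C (\<Union>v\<in>nearby Q e1 e2. \<gamma> ` near e1 e2 v)"
      by (simp add: image_UN)
    also have "\<dots> \<le> (\<Sum>v\<in>nearby Q e1 e2. curve_measure C (\<gamma> ` near e1 e2 v))"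
      by (intro curve_measure_finite_UN_le C_ne fin)
    also have "\<dots> \<le> (\<Sum>v\<in>nearby Q e1 e2. ennreal n)"
      unfolding n_def using Q1 e0 by (intro sum_mono curve_measure_near) (auto simp: nearby_def)
    also have "\<dots> = ennreal (real (card (nearby Q e1 e2)) * n)"
      using n0 by (simp add: ennreal_mult ennreal_of_nat_eq_real_of_nat)
    also have "\<dots> \<le> ennreal (K' * (Q * (e1 * e2) + h ^ 4 / Q))"
    proof (rule ennreal_leI)
      have "real (card (nearby Q e1 e2)) * n \<le> K * (max e1 e2 * Q\<^sup>2 + Q * h\<^sup>2) * n"
        unfolding h_def using card[OF Q e] n0 by (intro mult_right_mono) auto
      also have "\<dots> = K * (4 * L / c) * (Q * (max e1 e2 * min e1 e2) + h\<^sup>2 * min e1 e2)"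
        using Q1 c(1) unfolding n_def by (simp add: field_simps power2_eq_square)
      also have "max e1 e2 * min e1 e2 = e1 * e2" by (simp add: max_def min_def)
      also have "K * (4 * L / c) * (Q * (e1 * e2) + h\<^sup>2 * min e1 e2) \<le>
          K * (4 * L / c) * (2 * (Q * (e1 * e2) + h ^ 4 / Q))"
      proof (rule mult_left_mono)
        \<comment> \<open>The cross term \<open>h\<^sup>2 * min e1 e2\<close> is at most
          \<open>x * y\<close>. The weights \<open>sqrt Q\<close> are chosen so that
          \<open>x\<^sup>2\<close> is the main term and \<open>y\<^sup>2\<close> the remainder;
          squaring produces the fourth power of the logarithm.\<close>
        define x where "x = sqrt Q * sqrt (e1 * e2)"
        define y where "y = h\<^sup>2 / sqrt Q"
        have "(min e1 e2)\<^sup>2 \<le> e1 * e2"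
          using e0 by (auto simp: power2_eq_square intro!: mult_mono)
        then have "min e1 e2 \<le> sqrt (e1 * e2)" using e0 by (intro real_le_rsqrt) auto
        then have "h\<^sup>2 * min e1 e2 \<le> h\<^sup>2 * sqrt (e1 * e2)" by (intro mult_left_mono) auto
        also have "\<dots> = x * y" using Q1 by (simp add: x_def y_def)
        also have "\<dots> \<le> x\<^sup>2 + y\<^sup>2"
          using sum_squares_bound[of x y] zero_le_power2[of x] zero_le_power2[of y] by linarith
        also have "x\<^sup>2 = Q * (e1 * e2)" using Q1 e0 by (simp add: x_def power_mult_distrib)
        also have "y\<^sup>2 = h ^ 4 / Q" using Q1 by (simp add: y_def power_divide flip: power_mult)
        finally have "h\<^sup>2 * min e1 e2 \<le> Q * (e1 * e2) + h ^ 4 / Q" .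
        moreover have "h ^ 4 / Q \<ge> 0" using Q1 by (simp add: h_def)
        moreover have "b + a \<le> 2 * (b + d)" if "a \<le> b + d" "d \<ge> 0" for a b d :: real
          using that by simp
        ultimately show "Q * (e1 * e2) + h\<^sup>2 * min e1 e2 \<le> 2 * (Q * (e1 * e2) + h ^ 4 / Q)"
          by blast
      qed (use K L0 c in auto)
      finally show "real (card (nearby Q e1 e2)) * n \<le> K' * (Q * (e1 * e2) + h ^ 4 / Q)"
        by (simp add: K'_def mult_ac)
    qed
    finally show ?thesis by (simp add: h_def)
  qed
  then show ?thesis using Q0 K' by blast
qed

text \<open>One threshold \<Psi> serves the whole dyadic block of \<open>q\<close>; monotonicity of
  \<psi> makes this harmless.\<close>

definition close_times :: "nat \<Rightarrow> real \<Rightarrow> real set" where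
  "close_times j \<Psi> = {t \<in> {\<alpha>..\<beta>}. \<exists>q::nat. 2 ^ j \<le> q \<and> q < 2 * 2 ^ j \<and>
     dist_int (real q * \<gamma> t $ 1) * dist_int (real q * \<gamma> t $ 2) < \<Psi>}"

lemma close_times_subset:
  assumes "\<Psi> \<ge> (1/2) ^ (2 * j)"
  shows "close_times j \<Psi> \<subseteq> (\<Union>k\<le>2 * j. \<Union>v\<in>nearby (2 ^ j) ((1/2) ^ k) (min 1 (2 * 2 ^ k * \<Psi>)).
    near ((1/2) ^ k) (min 1 (2 * 2 ^ k * \<Psi>)) v)"
proof
  fix t assume "t \<in> close_times j \<Psi>"
  then obtain q :: nat where t: "t \<in> {\<alpha>..\<beta>}" and q: "2 ^ j \<le> q" "q < 2 * 2 ^ j"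
    and d: "dist_int (real q * \<gamma> t $ 1) * dist_int (real q * \<gamma> t $ 2) < \<Psi>"
    by (auto simp: close_times_def)
  obtain p1 p2 where p: "dist_int (real q * \<gamma> t $ 1) = \<bar>real q * \<gamma> t $ 1 - of_int p1\<bar>"
    "dist_int (real q * \<gamma> t $ 2) = \<bar>real q * \<gamma> t $ 2 - of_int p2\<bar>"
    using dist_int_attained by metis
  obtain k where k: "k \<le> 2 * j" "dist_int (real q * \<gamma> t $ 1) \<le> (1/2) ^ k"
    "dist_int (real q * \<gamma> t $ 2) \<le> min 1 (2 * 2 ^ k * \<Psi>)"
    using dyadic_split[OF dist_int_nonneg dist_int_le_1 dist_int_nonneg dist_int_le_1 d assms] by metis
  define v :: "int ^ 3" where "v = vector [p1, p2, int q]"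
  have v: "v $ 1 = p1" "v $ 2 = p2" "v $ 3 = int q" by (simp_all add: v_def vector_3)
  have n: "t \<in> near ((1/2) ^ k) (min 1 (2 * 2 ^ k * \<Psi>)) v"
    using t k(2,3) p by (simp add: near_def v)
  have "real (2 ^ j) \<le> real q" "real q < real (2 * 2 ^ j)"
    using q by (simp_all only: of_nat_le_iff of_nat_less_iff)
  then have "v \<in> nearby (2 ^ j) ((1/2) ^ k) (min 1 (2 * 2 ^ k * \<Psi>))"
    using n by (auto simp: nearby_def v)
  with n k(1) show "t \<in> (\<Union>k\<le>2 * j. \<Union>v\<in>nearby (2 ^ j) ((1/2) ^ k) (min 1 (2 * 2 ^ k * \<Psi>)).
    near ((1/2) ^ k) (min 1 (2 * 2 ^ k * \<Psi>)) v)" by blast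
qed

text \<open>Every box satisfies \<open>e1 * e2 \<le> 2 * \<Psi>\<close> whatever \<open>k\<close>
  is, so the \<open>2 * j + 1\<close> boxes obey one common bound.\<close>

lemma curve_measure_close_times:
  "\<exists>J0. \<exists>K\<ge>0. \<forall>j\<ge>J0. \<forall>\<Psi>\<ge>(1/2) ^ (2 * j).
    curve_measure C (\<gamma> ` close_times j \<Psi>) \<le>
    ennreal (K * (2 * real j + 1) * (2 * 2 ^ j * \<Psi> + (1 + real j) ^ 4 / 2 ^ j))"
proof -
  obtain Q0 K where Q0: "Q0 \<ge> 1" and K: "K \<ge> 0" and
    bound: "\<And>Q e1 e2. \<lbrakk>Q \<ge> Q0; e1 \<in> {0<..1}; e2 \<in> {0<..1}\<rbrakk> \<Longrightarrow>
      curve_measure C (\<gamma> ` (\<Union>v\<in>nearby Q e1 e2. near e1 e2 v)) \<le>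
      ennreal (K * (Q * (e1 * e2) + (1 + ln Q) ^ 4 / Q))"
    using curve_measure_nearby by metis
  obtain J0 where J0: "Q0 < 2 ^ J0" using real_arch_pow[of 2 Q0] by auto
  have "curve_measure C (\<gamma> ` close_times j \<Psi>) \<le>
      ennreal (K * (2 * real j + 1) * (2 * 2 ^ j * \<Psi> + (1 + real j) ^ 4 / 2 ^ j))"
    if j: "j \<ge> J0" and \<Psi>: "\<Psi> \<ge> (1/2) ^ (2 * j)" for j \<Psi>
  proof -
    let ?U = "\<lambda>k. \<Union>v\<in>nearby (2 ^ j) ((1/2) ^ k) (min 1 (2 * 2 ^ k * \<Psi>)).
      near ((1/2) ^ k) (min 1 (2 * 2 ^ k * \<Psi>)) v"
    have "(0::real) < (1/2) ^ (2 * j)" by simp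
    then have \<Psi>0: "\<Psi> > 0" using \<Psi> by linarith
    have "(2::real) ^ J0 \<le> 2 ^ j" using j by (intro power_increasing) auto
    then have Q: "(2::real) ^ j \<ge> Q0" using J0 by linarith
    let ?B = "K * (2 * 2 ^ j * \<Psi> + (1 + real j) ^ 4 / 2 ^ j)"
    have B0: "?B \<ge> 0" using K \<Psi>0 by simp
    have each: "curve_measure C (\<gamma> ` ?U k) \<le> ennreal ?B" for k
    proof -
      have "curve_measure C (\<gamma> ` ?U k) \<le>
          ennreal (K * (2 ^ j * ((1/2) ^ k * min 1 (2 * 2 ^ k * \<Psi>)) + (1 + ln (2 ^ j)) ^ 4 / 2 ^ j))"
        using Q \<Psi>0 by (intro bound) (auto simp: power_le_one)
      also have "\<dots> \<le> ennreal ?B"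
      proof -
        have "2 ^ j * ((1/2) ^ k * min 1 (2 * 2 ^ k * \<Psi>)) \<le> 2 ^ j * ((1/2) ^ k * (2 * 2 ^ k * \<Psi>))"
          by (intro mult_left_mono) auto
        also have "\<dots> = 2 * 2 ^ j * \<Psi>" by (simp add: field_simps power_divide)
        finally have "2 ^ j * ((1/2) ^ k * min 1 (2 * 2 ^ k * \<Psi>)) \<le> 2 * 2 ^ j * \<Psi>" .
        moreover have "(1 + ln (2 ^ j)) ^ 4 \<le> (1 + real j) ^ 4"
        proof (rule power_mono)
          have "ln 2 \<le> (1::real)" using ln_le_minus_one[of "2::real"] by simp
          then have "real j * ln 2 \<le> real j" by (intro mult_left_le) auto
          then show "1 + ln (2 ^ j) \<le> 1 + real j" by (simp add: ln_realpow)
        qed (simp add: ln_realpow)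
        ultimately show ?thesis
          by (intro ennreal_leI mult_left_mono add_mono divide_right_mono K) auto
      qed
      finally show ?thesis .
    qed
    have "curve_measure C (\<gamma> ` close_times j \<Psi>) \<le> curve_measure C (\<Union>k\<le>2 * j. \<gamma> ` ?U k)"
      using close_times_subset[OF \<Psi>] by (intro curve_measure_mono) (auto simp only: image_UN[symmetric])
    also have "\<dots> \<le> (\<Sum>k\<le>2 * j. curve_measure C (\<gamma> ` ?U k))"
      by (intro curve_measure_finite_UN_le C_ne) auto
    also have "\<dots> \<le> (\<Sum>k\<le>2 * j. ennreal ?B)" by (intro sum_mono each)
    also have "\<dots> = ennreal (real (2 * j + 1) * ?B)"
      using B0 by (simp add: ennreal_mult ennreal_of_nat_eq_real_of_nat[symmetric] del: of_nat_Suc of_nat_mult)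
    also have "real (2 * j + 1) * ?B = K * (2 * real j + 1) * (2 * 2 ^ j * \<Psi> + (1 + real j) ^ 4 / 2 ^ j)"
      by simp
    finally show ?thesis .
  qed
  then show ?thesis using K by blast
qed

text \<open>Borel-Cantelli: for every large \<open>n\<close> the blocks of index at least
  \<open>n\<close> cover the set, and the tails of the convergent series \<open>u\<close> tend to
  0.\<close>

lemma curve_measure_S2_star:
  assumes \<psi>: "approximating_function \<psi>"
    and sum: "summable (\<lambda>n. \<psi> (real (Suc n)) * ln (real (Suc n)))"
  shows "curve_measure C (\<gamma> ` {t \<in> {\<alpha>..\<beta>}. \<gamma> t \<in> S2_star \<psi>}) = 0"
proof -
  \<comment> \<open>The summand \<open>4\<^sup>-\<^sup>j\<close> keeps the number of dyadic boxes of order \<open>j\<close>.\<close>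
  define \<Psi> where "\<Psi> j = \<psi> (2 ^ j) + (1/2) ^ (2 * j)" for j :: nat
  have \<psi>pos: "\<psi> x > 0" if "x > 0" for x using \<psi> that by (simp add: approximating_function_def)
  have \<Psi>: "\<Psi> j \<ge> (1/2) ^ (2 * j)" for j using \<psi>pos[of "2 ^ j"] by (simp add: \<Psi>_def)
  obtain J0 K where K: "K \<ge> 0" and
    bound: "\<And>j P. \<lbrakk>j \<ge> J0; P \<ge> (1/2) ^ (2 * j)\<rbrakk> \<Longrightarrow>
      curve_measure C (\<gamma> ` close_times j P) \<le>
      ennreal (K * (2 * real j + 1) * (2 * 2 ^ j * P + (1 + real j) ^ 4 / 2 ^ j))"
    using curve_measure_close_times by metis
  define u where "u j = K * (2 * real j + 1) * (2 * 2 ^ j * \<Psi> j + (1 + real j) ^ 4 / 2 ^ j)" for j :: nat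
  have u0: "u j \<ge> 0" for j
  proof -
    have "(0::real) \<le> (1/2) ^ (2 * j)" by simp
    then have "\<Psi> j \<ge> 0" using \<Psi>[of j] by linarith
    then show ?thesis using K by (simp add: u_def)
  qed
  have "summable (\<lambda>j. (2 * real j + 1) * (2 ^ j * \<psi> (2 ^ j)))"
    by (rule summable_dyadic[OF \<psi> sum])
  moreover have "summable (\<lambda>j. (2 * real j + 1) * 2 ^ j * (1/2) ^ (2 * j))"
    by (rule summable_dyadic_remainder(1))
  moreover have "summable (\<lambda>j. (2 * real j + 1) * ((1 + real j) ^ 4 / 2 ^ j))"
    by (rule summable_dyadic_remainder(2))
  ultimately have "summable (\<lambda>j. K * (2 * ((2 * real j + 1) * (2 ^ j * \<psi> (2 ^ j))
      + (2 * real j + 1) * 2 ^ j * (1/2) ^ (2 * j)) + (2 * real j + 1) * ((1 + real j) ^ 4 / 2 ^ j)))"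
    by (intro summable_mult summable_add)
  also have "(\<lambda>j. K * (2 * ((2 * real j + 1) * (2 ^ j * \<psi> (2 ^ j))
      + (2 * real j + 1) * 2 ^ j * (1/2) ^ (2 * j)) + (2 * real j + 1) * ((1 + real j) ^ 4 / 2 ^ j))) = u"
    by (simp add: u_def \<Psi>_def fun_eq_iff algebra_simps)
  finally have u: "summable u" .
  let ?Z = "\<gamma> ` {t \<in> {\<alpha>..\<beta>}. \<gamma> t \<in> S2_star \<psi>}"
  have tail: "curve_measure C ?Z \<le> ennreal (\<Sum>i. u (i + n))" if n: "n \<ge> J0" for n
  proof -
    have "?Z \<subseteq> (\<Union>i. \<gamma> ` close_times (i + n) (\<Psi> (i + n)))"
    proof (rule image_subsetI)
      fix t assume "t \<in> {t \<in> {\<alpha>..\<beta>}. \<gamma> t \<in> S2_star \<psi>}"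
      then have t: "t \<in> {\<alpha>..\<beta>}" and inf: "infinite {q::nat. q > 0 \<and>
          dist_int (real q * \<gamma> t $ 1) * dist_int (real q * \<gamma> t $ 2) < \<psi> (real q)}"
        by (auto simp: S2_star_def)
      \<comment> \<open>Infinitely many solutions provide one with \<open>q \<ge> 2 ^ n\<close>,
        whose dyadic block has index at least \<open>n\<close>.\<close>
      obtain q :: nat where q: "q \<ge> 2 ^ n" "q > 0"
        "dist_int (real q * \<gamma> t $ 1) * dist_int (real q * \<gamma> t $ 2) < \<psi> (real q)"
        using inf unfolding infinite_nat_iff_unbounded_le by blast
      obtain j where j: "2 ^ j \<le> q" "q < 2 ^ Suc j" using ex_power_ivl1[of 2 q] q(2) by auto
      have "n \<le> j"
      proof (rule ccontr)
        assume "\<not> n \<le> j"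
        then have "(2::nat) ^ Suc j \<le> 2 ^ n" by (intro power_increasing) auto
        with q j show False by linarith
      qed
      then obtain i where i: "j = i + n" by (metis le_add_diff_inverse2)
      have "\<psi> (real q) \<le> \<psi> (2 ^ j)"
      proof -
        have "real (2 ^ j) \<le> real q" using j(1) by (simp only: of_nat_le_iff)
        then show ?thesis
          using \<psi> q(2) unfolding approximating_function_def monotone_on_def by auto
      qed
      then have "\<psi> (real q) \<le> \<Psi> j" by (simp add: \<Psi>_def add_increasing2)
      then have "t \<in> close_times j (\<Psi> j)"
        using t q(3) j by (auto simp: close_times_def intro!: exI[of _ q])
      then show "\<gamma> t \<in> (\<Union>i. \<gamma> ` close_times (i + n) (\<Psi> (i + n)))" using i by blast
    qed
    then have "curve_measure C ?Z \<le> curve_measure C (\<Union>i. \<gamma> ` close_times (i + n) (\<Psi> (i + n)))"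
      by (rule curve_measure_mono)
    also have "\<dots> \<le> (\<Sum>i. curve_measure C (\<gamma> ` close_times (i + n) (\<Psi> (i + n))))"
      by (rule curve_measure_UN_le)
    also have "\<dots> \<le> (\<Sum>i. ennreal (u (i + n)))"
      unfolding u_def using n by (intro suminf_le bound \<Psi>) auto
    also have "\<dots> = ennreal (\<Sum>i. u (i + n))"
      using u0 u by (intro suminf_ennreal2) (auto simp: summable_iff_shift)
    finally show ?thesis .
  qed
  have "(\<lambda>n. ennreal (\<Sum>i. u (i + n))) \<longlonglongrightarrow> ennreal 0"
    using suminf_exist_split2[OF u] by (intro tendsto_ennrealI)
  then have "curve_measure C ?Z \<le> ennreal 0"
  proof (rule tendsto_lowerbound)
    show "\<forall>\<^sub>F n in sequentially. curve_measure C ?Z \<le> ennreal (\<Sum>i. u (i + n))"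
      using tail by (rule eventually_sequentiallyI)
  qed simp
  then show ?thesis by simp
qed

end

section \<open>Parametrisation of rational quadrics\<close>

definition hom :: "real ^ 2 \<Rightarrow> real ^ 3" where
  "hom y = vector [y $ 1, y $ 2, 1]"

definition conic_of :: "real ^ 3 ^ 3 \<Rightarrow> (real ^ 2) set" where
  "conic_of H = {y. ((H *v hom y) $ 2)\<^sup>2 = (H *v hom y) $ 1 * (H *v hom y) $ 3}"

text \<open>Row \<open>i\<close> of \<open>G\<close> applied to (1, t, t^2), the rational
  parametrisation of the cone up to scale.\<close>

definition qform :: "real ^ 3 ^ 3 \<Rightarrow> 3 \<Rightarrow> real \<Rightarrow> real" where
  "qform G i t = G $ i $ 1 + G $ i $ 2 * t + G $ i $ 3 * t\<^sup>2"

text \<open>Here \<open>G\<close> is the inverse of the matrix that defines the conic. Times \<open>t\<close> with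
  \<open>qform G 3 t = 0\<close> give points at infinity, where the quotients below are junk.\<close>

definition conic_param :: "real ^ 3 ^ 3 \<Rightarrow> real \<Rightarrow> real ^ 2" where
  "conic_param G t = vector [qform G 1 t / qform G 3 t, qform G 2 t / qform G 3 t]"

definition wronskian :: "real ^ 3 ^ 3 \<Rightarrow> 3 \<Rightarrow> real \<Rightarrow> real" where
  "wronskian G i t =
    (G $ i $ 2 + 2 * G $ i $ 3 * t) * qform G 3 t - qform G i t * (G $ 3 $ 2 + 2 * G $ 3 $ 3 * t)"

definition conic_param_deriv :: "real ^ 3 ^ 3 \<Rightarrow> real \<Rightarrow> real ^ 2" where
  "conic_param_deriv G t = vector [wronskian G 1 t / (qform G 3 t)\<^sup>2, wronskian G 2 t / (qform G 3 t)\<^sup>2]"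

lemma qform_eq: "qform G i t = (G *v vector [1, t, t\<^sup>2]) $ i"
  by (simp add: qform_def matrix_vector_mult_def sum_3 vector_3)

lemma conic_param_lift:
  assumes "H ** G = mat 1" "qform G 3 t \<noteq> 0"
  shows "H *v hom (conic_param G t) = (1 / qform G 3 t) *\<^sub>R vector [1, t, t\<^sup>2]"
proof -
  have "hom (conic_param G t) = (1 / qform G 3 t) *\<^sub>R (G *v vector [1, t, t\<^sup>2])"
    using assms(2)
    by (simp add: vec_eq_iff forall_3 hom_def conic_param_def vector_3 vector_2 flip: qform_eq)
  then have "H *v hom (conic_param G t) = (1 / qform G 3 t) *\<^sub>R ((H ** G) *v vector [1, t, t\<^sup>2])"
    by (simp only: matrix_vector_mult_scaleR matrix_vector_mul_assoc)
  then show ?thesis using assms(1) by simp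
qed

lemma conic_param_in_conic:
  assumes "H ** G = mat 1" "qform G 3 t \<noteq> 0"
  shows "conic_param G t \<in> conic_of H"
  by (simp add: conic_of_def conic_param_lift[OF assms] vector_3 power2_eq_square)

text \<open>With \<open>?a \<noteq> 0\<close> the lifted point is \<open>?a\<close> times (1, t,
  t^2). Applying \<open>G\<close> returns \<open>hom y\<close>, whose last coordinate 1 shows that
  \<open>qform G 3 t\<close> is the inverse of \<open>?a\<close>.\<close>

lemma conic_param_surj:
  assumes GH: "G ** H = mat 1" and y: "y \<in> conic_of H" and a: "(H *v hom y) $ 1 \<noteq> 0"
  defines "t \<equiv> (H *v hom y) $ 2 / (H *v hom y) $ 1"
  shows "qform G 3 t \<noteq> 0 \<and> y = conic_param G t"
proof -
  let ?a = "(H *v hom y) $ 1"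
  have e: "((H *v hom y) $ 2)\<^sup>2 = ?a * (H *v hom y) $ 3" using y by (simp add: conic_of_def)
  have "(H *v hom y) $ 2 = ?a * t" using a by (simp add: t_def)
  moreover from this have "(H *v hom y) $ 3 = ?a * t\<^sup>2"
    using e a by (simp add: power2_eq_square mult_ac)
  ultimately have "H *v hom y = ?a *\<^sub>R vector [1, t, t\<^sup>2]"
    unfolding vec_eq_iff forall_3 by (simp add: vector_3)
  then have "G *v (H *v hom y) = G *v (?a *\<^sub>R vector [1, t, t\<^sup>2])" by (rule arg_cong)
  then have "hom y = ?a *\<^sub>R (G *v vector [1, t, t\<^sup>2])"
    by (simp only: matrix_vector_mul_assoc[of G H] GH matrix_vector_mul_lid matrix_vector_mult_scaleR)
  then have "hom y $ i = (?a *\<^sub>R (G *v vector [1, t, t\<^sup>2])) $ i" for i by (rule arg_cong)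
  then have eq: "hom y $ i = ?a * qform G i t" for i
    by (simp only: qform_eq vector_scaleR_component real_scaleR_def)
  then have "1 = ?a * qform G 3 t" "y $ 1 = ?a * qform G 1 t" "y $ 2 = ?a * qform G 2 t"
    using eq[of 3] eq[of 1] eq[of 2] by (simp_all add: hom_def vector_3)
  moreover from this have nz: "qform G 3 t \<noteq> 0" by auto
  ultimately have "y $ 1 = qform G 1 t / qform G 3 t" "y $ 2 = qform G 2 t / qform G 3 t"
    by (simp_all add: field_simps)
  with nz show ?thesis by (simp add: vec_eq_iff forall_2 conic_param_def vector_2)
qed

text \<open>The point missed by the parametrisation is the one with parameter \<open>t = \<infinity>\<close>.\<close>

lemma conic_point_at_infinity:
  assumes GH: "G ** H = mat 1"
  shows "\<exists>p. {y \<in> conic_of H. (H *v hom y) $ 1 = 0} \<subseteq> {p}"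
proof -
  \<comment> \<open>When the first coordinate vanishes, the conic equation kills the second, so
    \<open>hom y\<close> is a multiple of the third column of \<open>G\<close>; its last coordinate
    1 determines the multiple.\<close>
  have lift: "hom y $ k = (H *v hom y) $ 3 * G $ k $ 3"
    if y: "y \<in> conic_of H" "(H *v hom y) $ 1 = 0" for y k
  proof -
    define z where "z = H *v hom y"
    have "z $ 1 = 0" "z $ 2 = 0" using y by (simp_all add: conic_of_def z_def)
    then have "(G *v z) $ k = z $ 3 * G $ k $ 3"
      by (simp add: matrix_vector_mult_def sum_3)
    moreover have "G *v z = hom y"
      unfolding z_def by (simp only: matrix_vector_mul_assoc GH matrix_vector_mul_lid)
    ultimately show ?thesis by (simp only: z_def)
  qed
  have "y = y'" if y: "y \<in> conic_of H" "(H *v hom y) $ 1 = 0"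
    and y': "y' \<in> conic_of H" "(H *v hom y') $ 1 = 0" for y y'
  proof -
    define c c' where "c = (H *v hom y) $ 3" and "c' = (H *v hom y') $ 3"
    have c: "hom y $ k = c * G $ k $ 3" "hom y' $ k = c' * G $ k $ 3" for k
      using lift[OF y] lift[OF y'] unfolding c_def c'_def by blast+
    have "c * G $ 3 $ 3 = 1" "c' * G $ 3 $ 3 = 1"
      unfolding c[symmetric] by (simp_all add: hom_def vector_3)
    then have "c = c'" by (metis mult_cancel_right mult_zero_right zero_neq_one)
    then have "hom y $ k = hom y' $ k" for k unfolding c by simp
    from this[of 1] this[of 2] show ?thesis
      by (simp add: vec_eq_iff forall_2 hom_def vector_3)
  qed
  then show ?thesis by blast
qed

lemma qform_deriv: "(qform G i has_real_derivative (G $ i $ 2 + 2 * G $ i $ 3 * t)) (at t within S)"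
  unfolding qform_def by (auto intro!: derivative_eq_intros)

lemma conic_param_component_deriv:
  assumes "qform G 3 t \<noteq> 0"
  shows "((\<lambda>t. qform G i t / qform G 3 t) has_real_derivative wronskian G i t / (qform G 3 t)\<^sup>2) (at t within S)"
  using assms DERIV_divide[OF qform_deriv[of G i] qform_deriv[of G 3]]
  by (simp add: wronskian_def power2_eq_square)

lemma conic_param_has_deriv:
  assumes "qform G 3 t \<noteq> 0"
  shows "(conic_param G has_vector_derivative conic_param_deriv G t) (at t)"
proof -
  have eq: "vector [a, b] = a *\<^sub>R axis 1 1 + b *\<^sub>R (axis 2 1 :: real ^ 2)" for a b :: real
    by (simp add: vec_eq_iff forall_2 vector_2 axis_def)
  note d = conic_param_component_deriv[OF assms, of _ UNIV]
  show ?thesis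
    unfolding conic_param_def conic_param_deriv_def eq
    by (intro has_vector_derivative_add has_vector_derivative_scaleR[of _ _ _ _ "\<lambda>_. axis _ 1" 0, simplified] d)
qed

lemma continuous_qform [continuous_intros]:
  "continuous_on S (qform G i)" "continuous_on S (wronskian G i)"
  unfolding qform_def wronskian_def by (intro continuous_intros)+

text \<open>The cubic terms cancel, and up to a factor 2 the coefficients of the remaining quadratic
  \<open>p\<close> are the 2 by 2 minors of rows \<open>i\<close> and 3. If all of them vanished,
  expanding \<open>det G\<close> along the other row would give 0.\<close>

lemma finite_wronskian_zeros:
  assumes "det G \<noteq> 0" "i \<noteq> 3"
  shows "finite {t. wronskian G i t = 0}"
proof -
  define p where "p = [:G $ i $ 2 * G $ 3 $ 1 - G $ i $ 1 * G $ 3 $ 2,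
    2 * (G $ i $ 3 * G $ 3 $ 1 - G $ i $ 1 * G $ 3 $ 3), G $ i $ 3 * G $ 3 $ 2 - G $ i $ 2 * G $ 3 $ 3:]"
  have "p \<noteq> 0"
  proof
    assume "p = 0"
    then have "G $ i $ 2 * G $ 3 $ 1 = G $ i $ 1 * G $ 3 $ 2"
      "G $ i $ 3 * G $ 3 $ 1 = G $ i $ 1 * G $ 3 $ 3" "G $ i $ 3 * G $ 3 $ 2 = G $ i $ 2 * G $ 3 $ 3"
      by (simp_all add: p_def)
    moreover have "i = 1 \<or> i = 2" using exhaust_3[of i] assms(2) by auto
    moreover have "det G = G $ 2 $ 1 * (G $ 1 $ 3 * G $ 3 $ 2 - G $ 1 $ 2 * G $ 3 $ 3)
        + G $ 2 $ 2 * (G $ 1 $ 1 * G $ 3 $ 3 - G $ 1 $ 3 * G $ 3 $ 1)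
        + G $ 2 $ 3 * (G $ 1 $ 2 * G $ 3 $ 1 - G $ 1 $ 1 * G $ 3 $ 2)"
      "det G = G $ 1 $ 1 * (G $ 2 $ 2 * G $ 3 $ 3 - G $ 2 $ 3 * G $ 3 $ 2)
        + G $ 1 $ 2 * (G $ 2 $ 3 * G $ 3 $ 1 - G $ 2 $ 1 * G $ 3 $ 3)
        + G $ 1 $ 3 * (G $ 2 $ 1 * G $ 3 $ 2 - G $ 2 $ 2 * G $ 3 $ 1)"
      unfolding det_3 by algebra+
    ultimately have "det G = 0" by auto
    with assms(1) show False by simp
  qed
  moreover have "wronskian G i t = poly p t" for t
    by (simp add: p_def wronskian_def qform_def algebra_simps power2_eq_square)
  ultimately show ?thesis by (simp add: poly_roots_finite)
qed

text \<open>Mean value theorem, with \<open>c\<close> the minimum of the absolute derivative over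
  the compact interval; it is positive because the Wronskian has no zero there.\<close>

lemma conic_param_expanding:
  assumes w: "\<And>t. t \<in> {\<alpha>..\<beta>} \<Longrightarrow> qform G 3 t \<noteq> 0" "\<And>t. t \<in> {\<alpha>..\<beta>} \<Longrightarrow> wronskian G i t \<noteq> 0"
  shows "\<exists>c>0. \<forall>s\<in>{\<alpha>..\<beta>}. \<forall>t\<in>{\<alpha>..\<beta>}.
    c * \<bar>s - t\<bar> \<le> \<bar>qform G i s / qform G 3 s - qform G i t / qform G 3 t\<bar>"
proof (cases "\<alpha> \<le> \<beta>")
  case False
  then show ?thesis by (auto intro!: exI[of _ 1])
next
  case True
  let ?f = "\<lambda>t. qform G i t / qform G 3 t" and ?f' = "\<lambda>t. wronskian G i t / (qform G 3 t)\<^sup>2"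
  have "continuous_on {\<alpha>..\<beta>} (\<lambda>t. \<bar>?f' t\<bar>)"
    using w by (intro continuous_intros) auto
  then obtain t0 where t0: "t0 \<in> {\<alpha>..\<beta>}" "\<And>t. t \<in> {\<alpha>..\<beta>} \<Longrightarrow> \<bar>?f' t0\<bar> \<le> \<bar>?f' t\<bar>"
    using continuous_attains_inf[of "{\<alpha>..\<beta>}" "\<lambda>t. \<bar>?f' t\<bar>"] True by auto
  have lt: "\<bar>?f' t0\<bar> * \<bar>s - t\<bar> \<le> \<bar>?f s - ?f t\<bar>" if "s \<in> {\<alpha>..\<beta>}" "t \<in> {\<alpha>..\<beta>}" "s < t" for s t
  proof -
    have "\<exists>z>s. z < t \<and> ?f t - ?f s = (t - s) * ?f' z"
      using that w by (intro MVT2 conic_param_component_deriv) auto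
    then obtain z where z: "s < z" "z < t" "?f t - ?f s = (t - s) * ?f' z" by blast
    have "\<bar>?f' t0\<bar> * \<bar>s - t\<bar> \<le> \<bar>?f' z\<bar> * \<bar>s - t\<bar>"
      using t0(2)[of z] z that by (intro mult_right_mono) auto
    also have "\<dots> = \<bar>?f t - ?f s\<bar>" unfolding z(3) abs_mult by (simp add: abs_minus_commute mult.commute)
    finally show ?thesis by (simp add: abs_minus_commute)
  qed
  have "\<bar>?f' t0\<bar> * \<bar>s - t\<bar> \<le> \<bar>?f s - ?f t\<bar>" if "s \<in> {\<alpha>..\<beta>}" "t \<in> {\<alpha>..\<beta>}" for s t
    using lt[of s t] lt[of t s] that by (cases s t rule: linorder_cases) (auto simp: abs_minus_commute)
  moreover have "\<bar>?f' t0\<bar> > 0" using w t0(1) by simp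
  ultimately show ?thesis by blast
qed

lemma inj_int_matrix:
  fixes H :: "int ^ 3 ^ 3" and G :: "real ^ 3 ^ 3"
  assumes "G ** map_matrix of_int H = mat 1"
  shows "inj ((*v) H)"
proof (rule injI)
  fix v v' :: "int ^ 3" assume eq: "H *v v = H *v v'"
  let ?r = "\<lambda>v :: int ^ 3. (\<chi> i. real_of_int (v $ i))"
  have "map_matrix of_int H *v ?r v = ?r (H *v v)" for v
    by (simp add: vec_eq_iff matrix_vector_mult_def)
  then have "map_matrix of_int H *v ?r v = map_matrix of_int H *v ?r v'" using eq by simp
  then have "G *v (map_matrix of_int H *v ?r v) = G *v (map_matrix of_int H *v ?r v')" by (rule arg_cong)
  then have "?r v = ?r v'" by (simp only: matrix_vector_mul_assoc assms matrix_vector_mul_lid)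
  then show "v = v'" by (simp add: vec_eq_iff)
qed

text \<open>Compactness of the interval provides the constants of the locale. The scale \<mu> is
  \<open>1 / qform G 3 t\<close>, hence the demand for a positive denominator.\<close>

lemma conic_param_arc:
  fixes H :: "int ^ 3 ^ 3" and G :: "real ^ 3 ^ 3"
  defines "Hr \<equiv> map_matrix of_int H"
  assumes GH: "G ** Hr = mat 1" and HG: "Hr ** G = mat 1"
    and ne: "\<alpha> \<le> \<beta>"
    and w: "\<And>t. t \<in> {\<alpha>..\<beta>} \<Longrightarrow> qform G 3 t > 0"
      "\<And>t. t \<in> {\<alpha>..\<beta>} \<Longrightarrow> wronskian G 1 t \<noteq> 0" "\<And>t. t \<in> {\<alpha>..\<beta>} \<Longrightarrow> wronskian G 2 t \<noteq> 0"
  shows "\<exists>c L m M. conic_arc (conic_of Hr) (conic_param G) (conic_param_deriv G) \<alpha> \<beta> H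
    (\<lambda>t. 1 / qform G 3 t) c L m M"
proof -
  have w0: "qform G 3 t \<noteq> 0" if "t \<in> {\<alpha>..\<beta>}" for t using w(1)[OF that] by simp
  obtain c1 where c1: "c1 > 0" "\<And>s t. s \<in> {\<alpha>..\<beta>} \<Longrightarrow> t \<in> {\<alpha>..\<beta>} \<Longrightarrow>
      c1 * \<bar>s - t\<bar> \<le> \<bar>qform G 1 s / qform G 3 s - qform G 1 t / qform G 3 t\<bar>"
    using conic_param_expanding[OF w0 w(2)] by blast
  obtain c2 where c2: "c2 > 0" "\<And>s t. s \<in> {\<alpha>..\<beta>} \<Longrightarrow> t \<in> {\<alpha>..\<beta>} \<Longrightarrow>
      c2 * \<bar>s - t\<bar> \<le> \<bar>qform G 2 s / qform G 3 s - qform G 2 t / qform G 3 t\<bar>"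
    using conic_param_expanding[OF w0 w(3)] by blast
  have cont: "continuous_on {\<alpha>..\<beta>} (conic_param_deriv G)"
  proof -
    have eq: "vector [a, b] = a *\<^sub>R axis 1 1 + b *\<^sub>R (axis 2 1 :: real ^ 2)" for a b :: real
      by (simp add: vec_eq_iff forall_2 vector_2 axis_def)
    show ?thesis
      unfolding conic_param_deriv_def eq using w0 by (intro continuous_intros) auto
  qed
  obtain L where L: "\<And>t. t \<in> {\<alpha>..\<beta>} \<Longrightarrow> norm (conic_param_deriv G t) \<le> L"
    using compact_imp_bounded[OF compact_continuous_image[OF cont compact_Icc]]
    unfolding bounded_iff by blast
  have contw: "continuous_on {\<alpha>..\<beta>} (\<lambda>t. 1 / qform G 3 t)"
    using w0 by (intro continuous_intros) auto
  obtain t1 where t1: "t1 \<in> {\<alpha>..\<beta>}" "\<And>t. t \<in> {\<alpha>..\<beta>} \<Longrightarrow> 1 / qform G 3 t1 \<le> 1 / qform G 3 t"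
    using continuous_attains_inf[OF compact_Icc _ contw] ne by auto
  obtain t2 where t2: "t2 \<in> {\<alpha>..\<beta>}" "\<And>t. t \<in> {\<alpha>..\<beta>} \<Longrightarrow> 1 / qform G 3 t \<le> 1 / qform G 3 t2"
    using continuous_attains_sup[OF compact_Icc _ contw] ne by auto
  have in_C: "conic_param G t \<in> conic_of Hr" if "t \<in> {\<alpha>..\<beta>}" for t
    using conic_param_in_conic[OF HG w0[OF that]] .
  have expand: "min c1 c2 * \<bar>s - t\<bar> \<le> \<bar>conic_param G s $ i - conic_param G t $ i\<bar>"
    if "s \<in> {\<alpha>..\<beta>}" "t \<in> {\<alpha>..\<beta>}" for s t i
  proof -
    have "min c1 c2 * \<bar>s - t\<bar> \<le> c1 * \<bar>s - t\<bar>" "min c1 c2 * \<bar>s - t\<bar> \<le> c2 * \<bar>s - t\<bar>"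
      by (intro mult_right_mono; simp)+
    then show ?thesis
      using c1(2)[OF that] c2(2)[OF that] exhaust_2[of i] by (auto simp: conic_param_def vector_2)
  qed
  have lift: "map_matrix of_int H *v vector [conic_param G t $ 1, conic_param G t $ 2, 1] =
      vector [1 / qform G 3 t, 1 / qform G 3 t * t, 1 / qform G 3 t * t\<^sup>2]" if "t \<in> {\<alpha>..\<beta>}" for t
  proof -
    have "(vector [1 / q, 1 / q * t, 1 / q * t\<^sup>2] :: real ^ 3) = (1 / q) *\<^sub>R vector [1, t, t\<^sup>2]" for q
      by (simp add: vec_eq_iff forall_3 vector_3)
    with conic_param_lift[OF HG w0[OF that]] show ?thesis
      by (simp only: hom_def Hr_def)
  qed
  have "conic_arc (conic_of Hr) (conic_param G) (conic_param_deriv G) \<alpha> \<beta> H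
      (\<lambda>t. 1 / qform G 3 t) (min c1 c2) L (1 / qform G 3 t1) (1 / qform G 3 t2)"
  proof
    show "conic_of Hr \<noteq> {}" using in_C[of \<alpha>] ne by auto
    show "inj ((*v) H)" using inj_int_matrix GH unfolding Hr_def .
    show "(conic_param G has_vector_derivative conic_param_deriv G t) (at t)" if "t \<in> {\<alpha>..\<beta>}" for t
      using conic_param_has_deriv[OF w0[OF that]] .
    show "0 < 1 / qform G 3 t1" using w(1)[OF t1(1)] by simp
    show "conic_param G ` {\<alpha>..\<beta>} \<subseteq> conic_of Hr" using in_C by blast
    show "0 < min c1 c2" using c1(1) c2(1) by simp
    show "1 / qform G 3 t1 \<le> 1 / qform G 3 t \<and> 1 / qform G 3 t \<le> 1 / qform G 3 t2"
      if "t \<in> {\<alpha>..\<beta>}" for t using t1(2)[OF that] t2(2)[OF that] ..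
  qed (fact cont L expand lift)+
  then show ?thesis by blast
qed

section \<open>From compact arcs to the whole conic\<close>

text \<open>The sign condition loses nothing, since \<open>- G\<close> and \<open>- H\<close> define the same curve.\<close>

definition good_times :: "real ^ 3 ^ 3 \<Rightarrow> real set" where
  "good_times G = {t. qform G 3 t > 0 \<and> wronskian G 1 t \<noteq> 0 \<and> wronskian G 2 t \<noteq> 0}"

lemma open_good_times: "open (good_times G)"
proof -
  have "open {t. 0 < qform G 3 t}" "open {t. wronskian G 1 t \<noteq> 0}" "open {t. wronskian G 2 t \<noteq> 0}"
    by (intro open_Collect_less open_Collect_neq continuous_intros)+
  then show ?thesis unfolding good_times_def by (intro open_Collect_conj)
qed

text \<open>The open set \<open>good_times G\<close> is a countable union of compact intervals with
  rational endpoints, and the arc result applies to each of them.\<close>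

lemma curve_measure_good_times:
  fixes H :: "int ^ 3 ^ 3" and G :: "real ^ 3 ^ 3"
  defines "Hr \<equiv> map_matrix of_int H"
  assumes GH: "G ** Hr = mat 1" and HG: "Hr ** G = mat 1" and ne: "conic_of Hr \<noteq> {}"
    and \<psi>: "approximating_function \<psi>"
    and sum: "summable (\<lambda>n. \<psi> (real (Suc n)) * ln (real (Suc n)))"
  shows "curve_measure (conic_of Hr) (conic_param G ` {t \<in> good_times G. conic_param G t \<in> S2_star \<psi>}) = 0"
proof -
  define I :: "(rat \<times> rat) set" where
    "I = {(a, b). a \<le> b \<and> {of_rat a..of_rat b} \<subseteq> good_times G}"
  let ?E = "\<lambda>(a, b). conic_param G ` {t \<in> {real_of_rat a..of_rat b}. conic_param G t \<in> S2_star \<psi>}"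
  have null: "curve_measure (conic_of Hr) (?E i) = 0" if "i \<in> I" for i
  proof -
    obtain a b where i: "i = (a, b)" by (cases i)
    have ab: "real_of_rat a \<le> of_rat b" "{of_rat a..of_rat b} \<subseteq> good_times G"
      using that by (auto simp: I_def i of_rat_less_eq)
    obtain c L m M where "conic_arc (conic_of Hr) (conic_param G) (conic_param_deriv G) (of_rat a) (of_rat b) H
        (\<lambda>t. 1 / qform G 3 t) c L m M"
      using conic_param_arc[of G H "of_rat a" "of_rat b"] GH HG ab unfolding Hr_def good_times_def by blast
    from conic_arc.curve_measure_S2_star[OF this \<psi> sum] show ?thesis by (simp add: i)
  qed
  have "conic_param G ` {t \<in> good_times G. conic_param G t \<in> S2_star \<psi>} \<subseteq> (\<Union>i\<in>I. ?E i)"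
  proof (rule image_subsetI)
    fix t assume "t \<in> {t \<in> good_times G. conic_param G t \<in> S2_star \<psi>}"
    then have t: "t \<in> good_times G" "conic_param G t \<in> S2_star \<psi>" by auto
    obtain e where e: "e > 0" "cball t e \<subseteq> good_times G"
      using open_good_times t(1) open_contains_cball by metis
    obtain a where a: "t - e < of_rat a" "of_rat a < t" using of_rat_dense[of "t - e" t] e by auto
    obtain b where b: "t < of_rat b" "of_rat b < t + e" using of_rat_dense[of t "t + e"] e by auto
    have "{of_rat a..of_rat b} \<subseteq> cball t e" using a b by (auto simp: cball_def dist_real_def)
    moreover have "a \<le> b" using a b by (metis less_trans less_imp_le of_rat_less)
    ultimately have "(a, b) \<in> I" using e by (auto simp: I_def)
    moreover have "conic_param G t \<in> ?E (a, b)" using t a b by auto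
    ultimately show "conic_param G t \<in> (\<Union>i\<in>I. ?E i)" by blast
  qed
  from curve_measure_mono[OF this, of "conic_of Hr"] show ?thesis
    using curve_measure_countable_UN_null[of "conic_of Hr" I ?E, OF ne countableI_type null]
    by (simp only: le_zero_eq)
qed

lemma curve_measure_countable_null:
  assumes "C \<noteq> {}" "countable X" "X \<subseteq> C"
  shows "curve_measure C X = 0"
  using curve_measure_countable_UN_null[OF assms(1,2), of "\<lambda>p. {p}"] assms(3)
  by (auto simp: curve_measure_singleton subset_iff)

lemma minus_matrix_mult: "(- A) ** (- B) = A ** (B :: real ^ 'n ^ 'n)"
  by (simp add: vec_eq_iff matrix_matrix_mult_def)

text \<open>The good times of \<open>G\<close> and of \<open>- G\<close> cover the conic up to
  finitely many points: those whose parameter is a zero of a Wronskian, and the point with parameter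
  infinity.\<close>

lemma curve_measure_conic:
  fixes H :: "int ^ 3 ^ 3" and G :: "real ^ 3 ^ 3"
  defines "Hr \<equiv> map_matrix of_int H"
  assumes GH: "G ** Hr = mat 1" and ne: "conic_of Hr \<noteq> {}"
    and \<psi>: "approximating_function \<psi>"
    and sum: "summable (\<lambda>n. \<psi> (real (Suc n)) * ln (real (Suc n)))"
  shows "curve_measure (conic_of Hr) (conic_of Hr \<inter> S2_star \<psi>) = 0"
proof -
  have HG: "Hr ** G = mat 1" using GH matrix_left_right_inverse by blast
  have neg: "map_matrix of_int (- H) = - Hr" by (simp add: vec_eq_iff Hr_def)
  have "(- Hr) *v z = - (Hr *v z)" for z
    by (simp add: vec_eq_iff matrix_vector_mult_def sum_negf)
  then have conic_neg: "conic_of (- Hr) = conic_of Hr" by (simp add: conic_of_def)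
  have q_neg: "qform (- G) i t = - qform G i t" for i t by (simp add: qform_def)
  have w_neg: "wronskian (- G) i t = wronskian G i t" for i t
    unfolding wronskian_def q_neg by (simp add: algebra_simps)
  have p_neg: "conic_param (- G) = conic_param G" by (simp add: fun_eq_iff conic_param_def q_neg)
  have pos: "curve_measure (conic_of Hr) (conic_param G ` {t \<in> good_times G. conic_param G t \<in> S2_star \<psi>}) = 0"
    using curve_measure_good_times[of G H] GH HG ne \<psi> sum unfolding Hr_def by blast
  have minus: "curve_measure (conic_of Hr) (conic_param G ` {t \<in> good_times (- G). conic_param G t \<in> S2_star \<psi>}) = 0"
    using curve_measure_good_times[of "- G" "- H"] GH HG ne \<psi> sum
    unfolding neg conic_neg p_neg minus_matrix_mult by blast
  define Z where "Z = {t. wronskian G 1 t = 0} \<union> {t. wronskian G 2 t = 0}"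
  have "det G \<noteq> 0" using GH by (metis det_I det_mul mult_zero_left zero_neq_one)
  then have "finite Z" by (simp add: Z_def finite_wronskian_zeros)
  obtain p where p: "{y \<in> conic_of Hr. (Hr *v hom y) $ 1 = 0} \<subseteq> {p}"
    using conic_point_at_infinity[OF GH] by blast
  \<comment> \<open>The intersection discards junk values of \<open>conic_param\<close> at poles in
    \<open>Z\<close>, and \<open>p\<close> if it is off the curve: only countable subsets of the
    curve are known to be null.\<close>
  define X where "X = (conic_param G ` Z \<union> {p}) \<inter> conic_of Hr"
  have X: "curve_measure (conic_of Hr) X = 0"
    using \<open>finite Z\<close> by (intro curve_measure_countable_null ne) (auto simp: X_def intro: countable_finite)
  let ?P = "conic_param G ` {t \<in> good_times G. conic_param G t \<in> S2_star \<psi>}"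
  let ?N = "conic_param G ` {t \<in> good_times (- G). conic_param G t \<in> S2_star \<psi>}"
  have "conic_of Hr \<inter> S2_star \<psi> \<subseteq> (?P \<union> ?N) \<union> X"
  proof
    fix y assume y: "y \<in> conic_of Hr \<inter> S2_star \<psi>"
    show "y \<in> (?P \<union> ?N) \<union> X"
    proof (cases "(Hr *v hom y) $ 1 = 0")
      case True
      then show ?thesis using p y by (auto simp: X_def)
    next
      case False
      then obtain t where t: "qform G 3 t \<noteq> 0" "y = conic_param G t"
        using conic_param_surj[OF GH _ False] y by blast
      consider "t \<in> Z" | "t \<in> good_times G" | "t \<in> good_times (- G)"
        using t(1) by (cases "qform G 3 t > 0") (auto simp: Z_def good_times_def q_neg w_neg)
      then show ?thesis
      proof cases
        case 1
        then show ?thesis using y t(2) by (auto simp: X_def)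
      next
        case 2
        then have "y \<in> ?P" unfolding t(2) using y t(2) by (intro imageI) simp
        then show ?thesis by blast
      next
        case 3
        then have "y \<in> ?N" unfolding t(2) using y t(2) by (intro imageI) simp
        then show ?thesis by blast
      qed
    qed
  qed
  then have "curve_measure (conic_of Hr) (conic_of Hr \<inter> S2_star \<psi>) \<le> curve_measure (conic_of Hr) ((?P \<union> ?N) \<union> X)"
    by (rule curve_measure_mono)
  also have "\<dots> \<le> curve_measure (conic_of Hr) (?P \<union> ?N) + curve_measure (conic_of Hr) X"
    by (rule curve_measure_Un_le[OF ne])
  also have "\<dots> \<le> (curve_measure (conic_of Hr) ?P + curve_measure (conic_of Hr) ?N) + curve_measure (conic_of Hr) X"
    by (intro add_right_mono curve_measure_Un_le[OF ne])
  finally show ?thesis using pos minus X by simp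
qed

section \<open>Rational quadrics as preimages of the cone under integer matrices\<close>

lemma clear_denominators:
  fixes R :: "real ^ 3 ^ 3"
  assumes "\<And>i j. R $ i $ j \<in> \<rat>"
  shows "\<exists>d>0. \<exists>H :: int ^ 3 ^ 3. map_matrix of_int H = real_of_int d *\<^sub>R R"
proof -
  have "\<exists>d>0. \<exists>n. real_of_int d * R $ i $ j = of_int n" for i j
  proof -
    obtain r where r: "R $ i $ j = of_rat r" using assms Rats_cases by blast
    obtain n d where "quotient_of r = (n, d)" by (cases "quotient_of r")
    then have "r = of_int n / of_int d" "d > 0" using quotient_of_denom_pos quotient_of_div by auto
    then show ?thesis using r by (intro exI[of _ d] conjI exI[of _ n]) (simp_all add: of_rat_divide)
  qed
  then obtain d n where dn: "\<And>i j. d i j > (0 :: int)" "\<And>i j. real_of_int (d i j) * R $ i $ j = of_int (n i j)"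
    by metis
  define D where "D = (\<Prod>p\<in>UNIV. d (fst p) (snd p))"
  have D: "D > 0" using dn(1) by (auto simp: D_def intro!: prod_pos)
  have "D = d i j * (\<Prod>p\<in>UNIV - {(i, j)}. d (fst p) (snd p))" for i j
    unfolding D_def by (subst prod.remove[of _ "(i, j)"]) auto
  then have "real_of_int D * R $ i $ j =
      of_int (\<Prod>p\<in>UNIV - {(i, j)}. d (fst p) (snd p)) * (of_int (d i j) * R $ i $ j)" for i j
    by (metis (no_types) of_int_mult mult.assoc mult.commute)
  then have "real_of_int D * R $ i $ j = of_int ((\<Prod>p\<in>UNIV - {(i, j)}. d (fst p) (snd p)) * n i j)" for i j
    unfolding of_int_mult dn(2)[symmetric] .
  then have "map_matrix of_int (\<chi> i j. (\<Prod>p\<in>UNIV - {(i, j)}. d (fst p) (snd p)) * n i j) = real_of_int D *\<^sub>R R"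
    by (simp add: vec_eq_iff)
  then show ?thesis using D by blast
qed

text \<open>The rows of each matrix give a, x, b in a factorisation x^2 = a b: x1^2 = (1 - x2) (1 +
  x2) for the circle, x1^2 = 1 x2 for the parabola, 1^2 = (x1 - x2) (x1 + x2) for the
  hyperbola.\<close>

lemma standard_conics:
  assumes "K \<in> {unit_circle, std_parabola, std_hyperbola}"
  shows "\<exists>R. (\<forall>i j. R $ i $ j \<in> \<rat>) \<and> det R \<noteq> 0 \<and> conic_of R = K"
proof -
  consider "K = unit_circle" | "K = std_parabola" | "K = std_hyperbola" using assms by blast
  then show ?thesis
  proof cases
    case 1
    let ?R = "vector [vector [0, -1, 1], vector [1, 0, 0], vector [0, 1, 1]] :: real ^ 3 ^ 3"
    have "conic_of ?R = K"
      unfolding 1 by (auto simp: conic_of_def unit_circle_def hom_def matrix_vector_mult_def sum_3 vector_3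
          power2_eq_square algebra_simps)
    moreover have "\<forall>i j. ?R $ i $ j \<in> \<rat>" by (simp add: forall_3 vector_3)
    moreover have "det ?R \<noteq> 0" by (simp add: det_3 vector_3)
    ultimately show ?thesis by blast
  next
    case 2
    let ?R = "vector [vector [0, 0, 1], vector [1, 0, 0], vector [0, 1, 0]] :: real ^ 3 ^ 3"
    have "conic_of ?R = K"
      unfolding 2 by (auto simp: conic_of_def std_parabola_def hom_def matrix_vector_mult_def sum_3 vector_3)
    moreover have "\<forall>i j. ?R $ i $ j \<in> \<rat>" by (simp add: forall_3 vector_3)
    moreover have "det ?R \<noteq> 0" by (simp add: det_3 vector_3)
    ultimately show ?thesis by blast
  next
    case 3
    let ?R = "vector [vector [1, -1, 0], vector [0, 0, 1], vector [1, 1, 0]] :: real ^ 3 ^ 3"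
    have "conic_of ?R = K"
      unfolding 3 by (auto simp: conic_of_def std_hyperbola_def hom_def matrix_vector_mult_def sum_3 vector_3
          power2_eq_square algebra_simps)
    moreover have "\<forall>i j. ?R $ i $ j \<in> \<rat>" by (simp add: forall_3 vector_3)
    moreover have "det ?R \<noteq> 0" by (simp add: det_3 vector_3)
    ultimately show ?thesis by blast
  qed
qed

text \<open>The matrix of a standard conic is composed with the inverse affine map, which is again
  rational, and the denominators are then cleared.\<close>

lemma rational_quadric_conic:
  assumes "C \<in> rational_quadrics"
  shows "\<exists>(H :: int ^ 3 ^ 3) (G :: real ^ 3 ^ 3). G ** map_matrix of_int H = mat 1 \<and> C = conic_of (map_matrix of_int H)"
proof -
  obtain A b K where A: "invertible A" and K: "K \<in> {unit_circle, std_parabola, std_hyperbola}"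
    and C: "C = rational_affine A b ` K"
    using assms by (auto simp: rational_quadrics_def)
  obtain R where R: "\<And>i j. R $ i $ j \<in> \<rat>" "det R \<noteq> 0" "conic_of R = K"
    using standard_conics[OF K] by blast
  obtain A' where A': "A ** A' = mat 1" "A' ** A = mat 1" using A invertible_def by blast
  define Ar Ar' :: "real ^ 2 ^ 2" where "Ar = map_matrix of_rat A" and "Ar' = map_matrix of_rat A'"
  have hom_mult: "map_matrix real_of_rat X ** map_matrix of_rat Y = map_matrix of_rat (X ** Y)" for X Y :: "rat ^ 2 ^ 2"
    by (simp add: vec_eq_iff matrix_matrix_mult_def sum_2 of_rat_add of_rat_mult)
  have "map_matrix real_of_rat (mat 1 :: rat ^ 2 ^ 2) = mat 1" by (simp add: vec_eq_iff mat_def)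
  then have AA: "Ar ** Ar' = mat 1" "Ar' ** Ar = mat 1"
    by (simp_all only: Ar_def Ar'_def hom_mult A')
  define br :: "real ^ 2" where "br = (\<chi> i. of_rat (b $ i))"
  define pull where "pull y = Ar' *v (y - br)" for y
  have aff: "rational_affine A b x = Ar *v x + br" for x
    by (simp add: rational_affine_def Ar_def br_def)
  have pull1: "pull (Ar *v x + br) = x" for x by (simp add: pull_def matrix_vector_mul_assoc AA)
  have pull2: "Ar *v pull y + br = y" for y by (simp add: pull_def matrix_vector_mul_assoc AA)
  have C_pull: "C = {y. pull y \<in> K}"
  proof (intro equalityI subsetI)
    fix y assume "y \<in> C"
    then show "y \<in> {y. pull y \<in> K}" using pull1 by (auto simp: C aff)
  next
    fix y assume "y \<in> {y. pull y \<in> K}"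
    then show "y \<in> C" unfolding C aff by (intro image_eqI[of _ _ "pull y"]) (simp_all add: pull2)
  qed
  \<comment> \<open>The affine map \<open>pull\<close> as a linear map in homogeneous
    coordinates.\<close>
  define T :: "real ^ 3 ^ 3" where "T = vector
    [vector [Ar' $ 1 $ 1, Ar' $ 1 $ 2, - (Ar' *v br) $ 1],
     vector [Ar' $ 2 $ 1, Ar' $ 2 $ 2, - (Ar' *v br) $ 2],
     vector [0, 0, 1]]"
  have T_hom: "T *v hom y = hom (pull y)" for y
    by (simp add: vec_eq_iff forall_3 T_def hom_def pull_def matrix_vector_mult_def sum_3 sum_2 vector_3 algebra_simps)
  have "det T = det Ar'" by (simp add: T_def det_3 det_2 vector_3)
  moreover have "det Ar' \<noteq> 0" using AA(1) by (metis det_I det_mul mult_zero_right zero_neq_one)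
  ultimately have detT: "det (R ** T) \<noteq> 0" using R(2) by (simp add: det_mul)
  have "\<forall>i j. T $ i $ j \<in> \<rat>"
    by (auto simp: forall_3 T_def vector_3 Ar'_def br_def matrix_vector_mult_def sum_2 intro!: Rats_add Rats_mult Rats_minus_iff[THEN iffD2])
  then have "(R ** T) $ i $ j \<in> \<rat>" for i j
    using R(1) by (auto simp: matrix_matrix_mult_def sum_3 intro!: Rats_add Rats_mult)
  then obtain d and H :: "int ^ 3 ^ 3" where d: "d > 0" and H: "map_matrix of_int H = real_of_int d *\<^sub>R (R ** T)"
    using clear_denominators by blast
  have "C = conic_of (R ** T)"
    unfolding C_pull R(3)[symmetric] conic_of_def by (simp add: T_hom matrix_vector_mul_assoc[symmetric])
  \<comment> \<open>The conic equation is homogeneous: scaling the matrix by \<open>d\<close>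
    multiplies both sides by d^2.\<close>
  also have "\<dots> = conic_of (map_matrix of_int H)"
    using d unfolding H conic_of_def by (simp add: scaleR_matrix_vector_assoc[symmetric] power2_eq_square)
  finally have "C = conic_of (map_matrix of_int H)" .
  moreover obtain G where "(R ** T) ** G = mat 1" "G ** (R ** T) = mat 1"
    using detT invertible_det_nz[of "R ** T"] unfolding invertible_def by blast
  then have "((1 / real_of_int d) *\<^sub>R G) ** map_matrix of_int H = mat 1"
    using d unfolding H by (simp add: vec_eq_iff matrix_matrix_mult_def)
  ultimately show ?thesis by blast
qed

theorem theorem3:
  fixes \<psi> :: "real \<Rightarrow> real" and C :: "(real ^ 2) set"
  assumes "approximating_function \<psi>"
    and "C \<in> rational_quadrics"
    and "summable (\<lambda>n. \<psi> (real (Suc n)) * ln (real (Suc n)))"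
  shows "curve_measure C (C \<inter> S2_star \<psi>) = 0"
proof -
  obtain H :: "int ^ 3 ^ 3" and G :: "real ^ 3 ^ 3"
    where H: "G ** map_matrix of_int H = mat 1" "C = conic_of (map_matrix of_int H)"
    using rational_quadric_conic[OF assms(2)] by blast
  have "C \<noteq> {}"
  proof -
    have "vector [1, 0] \<in> unit_circle" "vector [0, 0] \<in> std_parabola" "vector [1, 0] \<in> std_hyperbola"
      by (simp_all add: unit_circle_def std_parabola_def std_hyperbola_def vector_2)
    then show ?thesis using assms(2) by (auto simp: rational_quadrics_def)
  qed
  then show ?thesis unfolding H(2) by (rule curve_measure_conic[OF H(1) _ assms(1,3)])
qed

end
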